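(* Let $1<p<\infty$, $\omega\in\mathcal R$, let $\varphi$ be a finite Blaschke product and let $u\in A_\omega^p$. If $uC_\varphi$ is bounded on $A_\omega^p$, then $u\in H^\infty(\mathbb D)$.
   Context: $\mathbb D$ is the open unit disk in $\mathbb C$, $H(\mathbb D)$ is the set of analytic functions on $\mathbb D$, $H^\infty=H^\infty(\mathbb D)$ is the set of bounded analytic functions on $\mathbb D$, and $dA(z)=\frac1\pi dx\,dy$. A weight is a positive radial function $\omega$ on $\mathbb D$, $\omega(z)=\omega(|z|)$, integrable on $(0,1)$; put $\hat\omega(r)=\int_r^1\omega(s)\,ds$. The weight $\omega$ is regular, written $\omega\in\mathcal R$, if there is a constant $C>0$ depending on $\omega$ such that $\frac1C<\frac{\hat\omega(r)}{(1-r)\omega(r)}<C$ for all $0<r<1$. $A_\omega^p$ is the space of $f\in H(\mathbb D)$ with $\|f\|_{A_\omega^p}^p=\int_{\mathbb D}|f|^p\omega\,dA<\infty$. The weighted composition operator is $(uC_\varphi f)(z)=u(z)f(\varphi(z))$. Finite Blaschke products are (nonconstant) analytic self-maps of $\mathbb D$. *)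

theory Defs
  imports "HOL-Complex_Analysis.Complex_Analysis"
begin

abbreviation unit_disk :: "complex set" where
  "unit_disk \<equiv> ball 0 1"

definition disk_area :: "complex measure" where
  "disk_area = scale_measure (ennreal (1 / pi)) (lebesgue_on unit_disk)"

text \<open>
  A weight is a function on the disk, given as a total function on the plane whose values
  outside the disk are irrelevant. Its radial profile is \<open>s \<mapsto> \<omega> (of_real s)\<close>.
\<close>

definition weight :: "(complex \<Rightarrow> real) \<Rightarrow> bool" where
  "weight \<omega> \<longleftrightarrow>
     (\<forall>z\<in>unit_disk. 0 < \<omega> z \<and> \<omega> z = \<omega> (of_real (norm z))) \<and>
     set_integrable lebesgue {0<..<1} (\<lambda>s::real. \<omega> (of_real s))"

definition weight_tail :: "(complex \<Rightarrow> real) \<Rightarrow> real \<Rightarrow> real" where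
  "weight_tail \<omega> r = set_lebesgue_integral lebesgue {r<..<1} (\<lambda>s::real. \<omega> (of_real s))"

definition regular_weights :: "(complex \<Rightarrow> real) set" where
  "regular_weights = {\<omega>. weight \<omega> \<and>
     (\<exists>C>0. \<forall>r. 0 < r \<and> r < 1 \<longrightarrow>
        1 / C < weight_tail \<omega> r / ((1 - r) * \<omega> (of_real r)) \<and>
        weight_tail \<omega> r / ((1 - r) * \<omega> (of_real r)) < C)}"

definition bergman_integral :: "real \<Rightarrow> (complex \<Rightarrow> real) \<Rightarrow> (complex \<Rightarrow> complex) \<Rightarrow> ennreal" where
  "bergman_integral p \<omega> f = (\<integral>\<^sup>+ z. ennreal (norm (f z) powr p * \<omega> z) \<partial>disk_area)"

definition bergman_space :: "real \<Rightarrow> (complex \<Rightarrow> real) \<Rightarrow> (complex \<Rightarrow> complex) set" where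
  "bergman_space p \<omega> = {f. f holomorphic_on unit_disk \<and> bergman_integral p \<omega> f < \<infinity>}"

definition bergman_norm :: "real \<Rightarrow> (complex \<Rightarrow> real) \<Rightarrow> (complex \<Rightarrow> complex) \<Rightarrow> real" where
  "bergman_norm p \<omega> f = enn2real (bergman_integral p \<omega> f) powr (1 / p)"

definition bounded_on_bergman_space ::
    "real \<Rightarrow> (complex \<Rightarrow> real) \<Rightarrow> ((complex \<Rightarrow> complex) \<Rightarrow> (complex \<Rightarrow> complex)) \<Rightarrow> bool" where
  "bounded_on_bergman_space p \<omega> T \<longleftrightarrow>
     (\<forall>f\<in>bergman_space p \<omega>. T f \<in> bergman_space p \<omega>) \<and>
     (\<exists>K. \<forall>f\<in>bergman_space p \<omega>. bergman_norm p \<omega> (T f) \<le> K * bergman_norm p \<omega> f)"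

definition weighted_composition ::
    "(complex \<Rightarrow> complex) \<Rightarrow> (complex \<Rightarrow> complex) \<Rightarrow> (complex \<Rightarrow> complex) \<Rightarrow> (complex \<Rightarrow> complex)" where
  "weighted_composition u \<phi> f = (\<lambda>z. u z * f (\<phi> z))"

text \<open>
  The list \<open>as\<close> enumerates the zeros with multiplicity; it is nonempty because unimodular
  constants are not self-maps of the disk. \<open>Moebius_function 0 a z\<close> is
  \<open>(z - a) / (1 - cnj a * z)\<close>.
\<close>

definition finite_Blaschke_product :: "(complex \<Rightarrow> complex) \<Rightarrow> bool" where
  "finite_Blaschke_product \<phi> \<longleftrightarrow>
     (\<exists>c as. norm c = 1 \<and> as \<noteq> [] \<and> set as \<subseteq> unit_disk \<and>
        (\<forall>z\<in>unit_disk. \<phi> z = c * (\<Prod>a\<leftarrow>as. Moebius_function 0 a z)))"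

definition H_infinity :: "(complex \<Rightarrow> complex) set" where
  "H_infinity = {f. f holomorphic_on unit_disk \<and> bounded (f ` unit_disk)}"

end

theory Submission
  imports Defs
begin

text \<open>
  Test the operator on \<open>f z = 1 / (1 - cnj a * z) ^ m\<close> with \<open>a = \<phi> z0\<close>. A finite Blaschke product is
  Lipschitz and \<open>1 - norm (\<phi> z)\<close> is comparable to \<open>1 - norm z\<close>, so near \<open>z0\<close> the function \<open>f \<circ> \<phi>\<close> is of
  size \<open>(1 - norm a) powr - m\<close>, and by the sub-mean value property the integral of \<open>u * (f \<circ> \<phi>)\<close> over
  a disk around \<open>z0\<close> bounds \<open>norm (u z0)\<close> from below. For large \<open>m\<close> the norm of \<open>f\<close> is
  bounded by the same quantity: the weight of a Carleson box of size \<open>\<rho>\<close> is at most a multiple of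
  \<open>\<rho> * weight_tail \<omega> (1 - \<rho>)\<close>, and regularity makes the tail doubling, so the boxes of
  size \<open>2 ^ k * (1 - norm a)\<close> contribute a geometric series. The two bounds differ by a constant factor.
\<close>

section \<open>Lebesgue measure in the plane: rotations and radial functions\<close>

text \<open>Put \<open>d = 1 - norm z0\<close>, \<open>\<delta> = 1 - norm a\<close>,
  \<open>q = m * p\<close>, and write \<open>T\<close> for the tail. The two bounds are multiples of
  \<open>\<delta> powr - q * d * T (1 - d)\<close> and
  \<open>\<delta> powr - q * \<delta> * T (1 - \<delta>)\<close>. The estimate
  \<open>b * d \<le> \<delta>\<close> keeps the image under \<phi> of the disk around
  \<open>z0\<close> within a multiple of \<delta> of \<open>a\<close>, where the kernel is still of
  full size. The opposite estimate \<open>\<delta> \<le> K * d\<close>, with doubling, turns the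
  second bound into the first. The technical obstacle is measurability: the weight is merely
  Lebesgue measurable along a radius, and regularity speaks of \<open>0 < r < 1\<close> only.
  Integrals are therefore compared with those of the Borel function \<open>T r / (1 - r)\<close>.
  Polar coordinates and the mean value inequality are obtained for nonnegative integrals directly,
  by a pushforward under the norm and by averages over roots of unity.\<close>

lemma nn_integral_lborel_shift:
  fixes f :: "'a::euclidean_space \<Rightarrow> ennreal"
  assumes [measurable]: "f \<in> borel_measurable borel"
  shows "(\<integral>\<^sup>+ x. f (x + c) \<partial>lborel) = (\<integral>\<^sup>+ x. f x \<partial>lborel)"
proof -
  have "(\<integral>\<^sup>+ x. f x \<partial>lborel) = (\<integral>\<^sup>+ x. f x \<partial>distr lborel borel ((+) c))"
    by (simp add: lborel_distr_plus)
  also have "\<dots> = (\<integral>\<^sup>+ x. f (x + c) \<partial>lborel)"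
    by (subst nn_integral_distr) (auto simp: add.commute)
  finally show ?thesis by simp
qed

text \<open>As in the uniqueness proof for Haar measure: compute the integral of
  \<open>indicator A (c * x) * indicator B (c * x - y)\<close> over \<open>x\<close> and \<open>y\<close> in both orders, where \<open>B\<close> is the
  unit disk, which the rotation preserves.\<close>

lemma distr_lborel_rotation:
  fixes c :: complex
  assumes "norm c = 1"
  shows "distr lborel borel ((*) c) = lborel"
proof (rule measure_eqI)
  show "sets (distr lborel borel ((*) c)) = sets lborel" by simp
next
  fix A assume "A \<in> sets (distr lborel borel ((*) c))"
  then have A [measurable]: "A \<in> sets borel" by simp
  define B :: "complex set" where "B = ball 0 1"
  have B [measurable]: "B \<in> sets borel" by (simp add: B_def)
  have c0: "c \<noteq> 0" using assms by auto
  define b where "b = emeasure lborel B"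
  \<comment> \<open>The final cancellation takes place in \<open>ennreal\<close>, where the measure
    of \<open>A\<close> may be infinite; a factor that is neither 0 nor infinite can still be
    cancelled.\<close>
  have b: "b \<noteq> 0" "b \<noteq> \<infinity>"
    unfolding b_def B_def by (auto simp: emeasure_ball unit_ball_vol_2)
  have "emeasure lborel {x. c * x \<in> A} * b
      = (\<integral>\<^sup>+ x. indicator A (c * x) * b \<partial>lborel)"
  proof -
    have "(\<integral>\<^sup>+ x. indicator A (c * x) * b \<partial>lborel) = (\<integral>\<^sup>+ x. b * indicator {x. c * x \<in> A} x \<partial>lborel)"
      by (intro nn_integral_cong) (auto simp: indicator_def)
    also have "\<dots> = b * emeasure lborel {x. c * x \<in> A}"
      by (intro nn_integral_cmult_indicator) measurable
    finally show ?thesis by (simp add: mult.commute)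
  qed
  also have "\<dots> = (\<integral>\<^sup>+ x. indicator A (c * x) * (\<integral>\<^sup>+ y. indicator B (c * x - y) \<partial>lborel) \<partial>lborel)"
  proof (rule nn_integral_cong)
    fix x
    have "(\<integral>\<^sup>+ y. indicator B (c * x - y) \<partial>lborel) = (\<integral>\<^sup>+ y. indicator (ball (c * x) 1) y \<partial>lborel)"
      by (intro nn_integral_cong) (auto simp: indicator_def B_def dist_norm norm_minus_commute)
    also have "\<dots> = b" unfolding b_def B_def by (simp add: emeasure_ball)
    finally show "indicator A (c * x) * b = indicator A (c * x) * (\<integral>\<^sup>+ y. indicator B (c * x - y) \<partial>lborel)"
      by simp
  qed
  also have "\<dots> = (\<integral>\<^sup>+ x. (\<integral>\<^sup>+ y. indicator A (c * x) * indicator B (c * x - y) \<partial>lborel) \<partial>lborel)"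
    by (intro nn_integral_cong nn_integral_cmult[symmetric]) measurable
  also have "\<dots> = (\<integral>\<^sup>+ y. (\<integral>\<^sup>+ x. indicator A (c * x) * indicator B (c * x - y) \<partial>lborel) \<partial>lborel)"
    by (rule lborel_pair.Fubini') measurable
  also have "\<dots> = (\<integral>\<^sup>+ y. (\<integral>\<^sup>+ x. indicator A (c * x + y) * indicator B (c * x) \<partial>lborel) \<partial>lborel)"
  proof (rule nn_integral_cong)
    \<comment> \<open>Translation by \<open>y / c\<close> moves \<open>y\<close> from the indicator
      of \<open>B\<close> to that of \<open>A\<close>, so the integral over \<open>y\<close> becomes
      the measure of a translate of \<open>A\<close>.\<close>
    fix y
    have "(\<integral>\<^sup>+ x. indicator A (c * x) * indicator B (c * x - y) \<partial>lborel)
        = (\<integral>\<^sup>+ x. (indicator A (c * (x + y / c)) * indicator B (c * (x + y / c) - y) :: ennreal) \<partial>lborel)"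
      by (rule nn_integral_lborel_shift[symmetric]) measurable
    also have "\<dots> = (\<integral>\<^sup>+ x. indicator A (c * x + y) * indicator B (c * x) \<partial>lborel)"
      using c0 by (simp add: algebra_simps)
    finally show "(\<integral>\<^sup>+ x. indicator A (c * x) * indicator B (c * x - y) \<partial>lborel)
      = (\<integral>\<^sup>+ x. (indicator A (c * x + y) * indicator B (c * x) :: ennreal) \<partial>lborel)" by simp
  qed
  also have "\<dots> = (\<integral>\<^sup>+ x. (\<integral>\<^sup>+ y. indicator A (c * x + y) * indicator B (c * x) \<partial>lborel) \<partial>lborel)"
    by (rule lborel_pair.Fubini') measurable
  also have "\<dots> = (\<integral>\<^sup>+ x. emeasure lborel A * indicator B x \<partial>lborel)"
  proof (rule nn_integral_cong)
    fix x
    have "(\<integral>\<^sup>+ y. indicator A (c * x + y) * indicator B (c * x) \<partial>lborel)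
       = (\<integral>\<^sup>+ y. indicator A (y + c * x) \<partial>lborel) * indicator B (c * x)"
      by (subst nn_integral_multc) (auto simp: add.commute)
    also have "(\<integral>\<^sup>+ y. indicator A (y + c * x) \<partial>lborel) = (\<integral>\<^sup>+ y. indicator A y \<partial>lborel)"
      by (rule nn_integral_lborel_shift) measurable
    also have "\<dots> = emeasure lborel A" by simp
    finally show "(\<integral>\<^sup>+ y. indicator A (c * x + y) * indicator B (c * x) \<partial>lborel) = emeasure lborel A * indicator B x"
      using assms by (auto simp: indicator_def B_def norm_mult)
  qed
  also have "\<dots> = emeasure lborel A * b"
    unfolding b_def by (intro nn_integral_cmult_indicator) simp
  finally have "emeasure lborel {x. c * x \<in> A} = emeasure lborel A"
    using b by (simp add: ennreal_mult_cancel_left mult.commute[of _ b])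
  then show "emeasure (distr lborel borel ((*) c)) A = emeasure lborel A"
    by (subst emeasure_distr) (auto simp: vimage_def)
qed

lemma nn_integral_lborel_rotation:
  fixes f :: "complex \<Rightarrow> ennreal"
  assumes "norm c = 1" and [measurable]: "f \<in> borel_measurable borel"
  shows "(\<integral>\<^sup>+ z. f (c * z) \<partial>lborel) = (\<integral>\<^sup>+ z. f z \<partial>lborel)"
proof -
  have "(\<integral>\<^sup>+ z. f z \<partial>lborel) = (\<integral>\<^sup>+ z. f z \<partial>distr lborel borel ((*) c))"
    by (simp add: distr_lborel_rotation assms)
  also have "\<dots> = (\<integral>\<^sup>+ z. f (c * z) \<partial>lborel)"
    by (subst nn_integral_distr) auto
  finally show ?thesis by simp
qed

lemma emeasure_lborel_ball_complex:
  "0 \<le> r \<Longrightarrow> emeasure lborel (ball (a::complex) r) = ennreal (pi * r\<^sup>2)"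
  by (subst emeasure_ball) (auto simp: unit_ball_vol_2)

text \<open>Polar coordinates by uniqueness of measures: the pushforward \<open>M\<close> of area on
  the disk under \<open>norm\<close> and the measure \<open>N\<close> with density
  \<open>2 * pi * r\<close> give every half-line the same finite mass. Clamping \<open>x\<close> to
  the unit interval lets one formula serve all half-lines.\<close>

lemma nn_integral_radial:
  fixes g :: "real \<Rightarrow> ennreal"
  assumes [measurable]: "g \<in> borel_measurable borel"
  shows "(\<integral>\<^sup>+ z. g (norm z) * indicator (ball (0::complex) 1) z \<partial>lborel)
       = (\<integral>\<^sup>+ r. ennreal (2 * pi * r) * g r * indicator {0<..<1} r \<partial>lborel)"
proof -
  define M where "M = distr (density lborel (indicator (ball (0::complex) 1))) borel norm"
  define N where "N = density lborel (\<lambda>r::real. ennreal (2 * pi * r) * indicator {0<..<1} r)"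
  have [measurable]: "ball (0::complex) 1 \<in> sets borel" by simp
  have M: "emeasure M {x<..} = ennreal (pi - pi * (max 0 (min 1 x))\<^sup>2)" for x
  proof -
    define m where "m = max 0 (min 1 x)"
    have m: "0 \<le> m" "m \<le> 1" by (auto simp: m_def)
    have "emeasure M {x<..} = emeasure lborel (ball (0::complex) 1 \<inter> {z. x < norm z})"
      unfolding M_def
      by (simp add: emeasure_distr emeasure_restricted vimage_def)
    also have "\<dots> = ennreal (pi - pi * m\<^sup>2)"
    proof (cases "0 \<le> x")
      case True
      have I: "emeasure lborel (ball 0 1 \<inter> cball (0::complex) m) = ennreal (pi * m\<^sup>2)"
      proof (cases "m = 1")
        case True
        then have "ball 0 1 \<inter> cball (0::complex) m = ball 0 1" by auto
        then show ?thesis using True by (simp add: emeasure_lborel_ball_complex)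
      next
        case False
        then have "ball 0 1 \<inter> cball (0::complex) m = cball 0 m" using m by auto
        then show ?thesis using m by (simp add: emeasure_cball unit_ball_vol_2)
      qed
      have "emeasure lborel (ball (0::complex) 1 \<inter> {z. x < norm z}) = emeasure lborel (ball (0::complex) 1 - ball 0 1 \<inter> cball 0 m)"
        using True by (auto simp: m_def intro!: arg_cong[where f = "emeasure lborel"])
      also have "\<dots> = emeasure lborel (ball (0::complex) 1) - emeasure lborel (ball 0 1 \<inter> cball (0::complex) m)"
        by (rule emeasure_Diff) (auto simp: I)
      also have "\<dots> = ennreal (pi - pi * m\<^sup>2)"
        using m unfolding I by (simp add: emeasure_lborel_ball_complex ennreal_minus)
      finally show ?thesis .
    next
      case False
      then have "ball (0::complex) 1 \<inter> {z. x < norm z} = ball 0 1"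
        by (auto intro: less_le_trans[OF _ norm_ge_zero])
      then show ?thesis using False by (simp add: m_def emeasure_lborel_ball_complex)
    qed
    finally show ?thesis by (simp add: m_def)
  qed
  have N: "emeasure N {x<..} = ennreal (pi - pi * (max 0 (min 1 x))\<^sup>2)" for x
  proof -
    define m where "m = max 0 (min 1 x)"
    have m: "0 \<le> m" "m \<le> 1" by (auto simp: m_def)
    have "emeasure N {x<..} = (\<integral>\<^sup>+ r. ennreal (2 * pi * r) * indicator {0<..<1} r * indicator {x<..} r \<partial>lborel)"
      unfolding N_def by (subst emeasure_density) auto
    also have "\<dots> = (\<integral>\<^sup>+ r. ennreal (2 * pi * r) * indicator {m..1} r \<partial>lborel)"
      by (intro nn_integral_cong_AE AE_I'[OF finite_imp_null_set_lborel[of "{m, 1, 0, x}"]])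
         (auto simp: indicator_def m_def split: if_splits)
    also have "\<dots> = ennreal (pi * 1\<^sup>2 - pi * m\<^sup>2)"
      using m by (intro nn_integral_FTC_Icc) (auto intro!: derivative_eq_intros)
    finally show ?thesis by (simp add: m_def)
  qed
  have MN: "M = N"
    by (rule measure_eqI_lessThan) (auto simp: M N M_def[THEN arg_cong[where f = sets]] N_def[THEN arg_cong[where f = sets]])
  have "(\<integral>\<^sup>+ z. g (norm z) * indicator (ball (0::complex) 1) z \<partial>lborel) = (\<integral>\<^sup>+ r. g r \<partial>M)"
    unfolding M_def by (subst nn_integral_distr, simp, simp, subst nn_integral_density) (auto simp: mult.commute)
  also have "\<dots> = (\<integral>\<^sup>+ r. ennreal (2 * pi * r) * indicator {0<..<1} r * g r \<partial>lborel)"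
    unfolding MN N_def by (subst nn_integral_density) auto
  finally show ?thesis by (simp add: mult_ac)
qed

section \<open>The sub-mean value property\<close>

text \<open>The point 0 is included because the moduli averaged later may vanish. If one of the two
  points is 0, the inequality reduces to \<open>v powr p \<le> v\<close> on the unit
  interval.\<close>

lemma convex_on_powr_atLeast_0:
  assumes "1 \<le> p" shows "convex_on {0..} (\<lambda>x::real. x powr p)"
proof -
  have z: "(v * y) powr p \<le> v * y powr p" if "0 \<le> v" "v \<le> 1" "0 \<le> y" for v y :: real
  proof -
    have "v powr p \<le> v"
      using that assms by (cases "v = 0") (auto intro: order_trans[OF powr_mono'[of 1 p v]])
    then show ?thesis using that by (simp add: powr_mult mult_right_mono)
  qed
  show ?thesis
  proof (rule convex_onI)
    fix t x y :: real assume t: "0 < t" "t < 1" and xy: "x \<in> {0..}" "y \<in> {0..}"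
    show "((1 - t) *\<^sub>R x + t *\<^sub>R y) powr p \<le> (1 - t) * x powr p + t * y powr p"
    proof (cases "x = 0 \<or> y = 0")
      case True
      then show ?thesis using z[of t y] z[of "1 - t" x] t xy by auto
    next
      case False
      then show ?thesis
        using convex_onD[OF powr_convex[OF assms], of t x y] t xy by auto
    qed
  qed auto
qed

lemma powr_mean_le:
  fixes x :: "nat \<Rightarrow> real"
  assumes "1 \<le> p" "0 < N" "\<And>k. k < N \<Longrightarrow> 0 \<le> x k"
  shows "((\<Sum>k<N. x k) / N) powr p \<le> (\<Sum>k<N. x k powr p) / N"
proof -
  have "(\<Sum>k<N. (1/N) *\<^sub>R x k) powr p \<le> (\<Sum>k<N. (1/N) * x k powr p)"
    using assms by (intro convex_on_sum[OF _ _ convex_on_powr_atLeast_0]) auto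
  then show ?thesis by (simp add: sum_divide_distrib)
qed

text \<open>A geometric sum whose ratio \<open>w\<close> satisfies \<open>w ^ N = 1\<close>; the
  ratio is not 1, since otherwise \<open>N\<close> would divide \<open>n\<close>.\<close>

lemma sum_root_unity_powers:
  fixes N n :: nat
  assumes "0 < N" "0 < n" "n < N"
  shows "(\<Sum>k<N. (cis (2 * pi * real k / N)) ^ n) = 0"
proof -
  define w where "w = cis (2 * pi * n / N)"
  have "w \<noteq> 1"
  proof
    assume "w = 1"
    then have "cos (2 * pi * n / N) = 1" by (simp add: w_def complex_eq_iff)
    then obtain j :: int where "2 * pi * n / N = of_int j * 2 * pi"
      using cos_one_2pi_int by auto
    then have "real n = of_int j * real N" using assms by (simp add: field_simps)
    then have "int n = j * int N" by (metis of_int_eq_iff of_int_mult of_int_of_nat_eq)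
    then have "int N dvd int n" by simp
    then have "N dvd n" by simp
    then show False using assms by (auto dest: dvd_imp_le)
  qed
  have "w ^ N = 1"
  proof -
    have "w ^ N = cis (real N * (2 * pi * n / N))" unfolding w_def by (rule Complex.DeMoivre)
    also have "real N * (2 * pi * n / N) = 2 * pi * n" using assms by simp
    finally show ?thesis by simp
  qed
  have "(\<Sum>k<N. (cis (2 * pi * real k / N)) ^ n) = (\<Sum>k<N. w ^ k)"
    by (intro sum.cong) (auto simp: w_def Complex.DeMoivre field_simps)
  also have "\<dots> = 0" using \<open>w \<noteq> 1\<close> \<open>w ^ N = 1\<close> by (simp add: geometric_sum)
  finally show ?thesis .
qed

text \<open>A discrete form of the mean value property. Averaging over the \<open>N\<close>-th roots
  of unity kills the Taylor terms of degree \<open>0 < n < N\<close>, and the terms from degree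
  \<open>N\<close> on are bounded, uniformly in the rotation, by the tail of an absolutely
  convergent series.\<close>

lemma tendsto_mean_rotations:
  fixes f :: "complex \<Rightarrow> complex"
  assumes f: "f holomorphic_on ball z0 R" and "norm w < R"
  shows "(\<lambda>N::nat. (\<Sum>k<N. f (z0 + cis (2 * pi * real k / N) * w)) / N) \<longlonglongrightarrow> f z0"
proof -
  define c where "c = (\<lambda>n. (deriv ^^ n) f z0 / fact n)"
  have c: "(\<lambda>n. c n * v ^ n) sums f (z0 + v)" if "norm v < R" for v
    using holomorphic_power_series[OF f, of "z0 + v"] that by (simp add: c_def dist_norm)
  obtain r where r: "norm w < r" "r < R" using assms(2) dense by blast
  have r0: "0 < r" using r(1) norm_ge_zero[of w] by linarith
  \<comment> \<open>Convergence at a radius strictly beyond \<open>norm w\<close> gives absolute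
    convergence at \<open>w\<close>.\<close>
  have "summable (\<lambda>n. c n * of_real r ^ n)" 
    using c[of "of_real r"] r r0 by (auto simp: sums_iff)
  then have S: "summable (\<lambda>n. norm (c n * w ^ n))"
    by (rule powser_insidea) (use r r0 in auto)
  define t where "t = (\<lambda>N. \<Sum>n. norm (c (n + N) * w ^ (n + N)))"
  have t: "t \<longlonglongrightarrow> 0"
    unfolding t_def by (rule suminf_exist_split2[OF S])
  have bound: "norm ((\<Sum>k<N. f (z0 + cis (2 * pi * real k / N) * w)) / N - f z0) \<le> t N" if N: "N > 0" for N :: nat
  proof -
    define e where "e = (\<lambda>k::nat. cis (2 * pi * real k / N))"
    have ne: "norm (e k) = 1" for k by (simp add: e_def)
    have s: "(\<lambda>n. c n * (e k * w) ^ n) sums f (z0 + e k * w)" for k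
      by (rule c) (use assms(2) ne in \<open>auto simp: norm_mult\<close>)
    have nrm: "norm (c n * (e k * w) ^ n) = norm (c n * w ^ n)" for k n
      by (simp add: norm_mult norm_power ne power_mult_distrib)
    have split: "f (z0 + e k * w) = (\<Sum>n. c (n + N) * (e k * w) ^ (n + N)) + (\<Sum>n<N. c n * (e k * w) ^ n)" for k
      using suminf_split_initial_segment[OF sums_summable[OF s], of k N] sums_unique[OF s, of k] by simp
    have tail: "norm (\<Sum>n. c (n + N) * (e k * w) ^ (n + N)) \<le> t N" for k
    proof -
      have "summable (\<lambda>n. norm (c (n + N) * (e k * w) ^ (n + N)))"
        unfolding nrm using summable_ignore_initial_segment[OF S] .
      from summable_norm[OF this] show ?thesis by (simp add: nrm t_def)
    qed
    have "(\<Sum>k<N. \<Sum>n<N. c n * (e k * w) ^ n) = (\<Sum>n<N. c n * w ^ n * (\<Sum>k<N. e k ^ n))"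
      by (subst sum.swap) (simp add: sum_distrib_left power_mult_distrib mult_ac)
    also have "\<dots> = (\<Sum>n<N. if n = 0 then c 0 * N else 0)"
      unfolding e_def using sum_root_unity_powers[of N] N by (intro sum.cong) auto
    also have "\<dots> = c 0 * N" using N by simp
    also have "c 0 = f z0" by (simp add: c_def)
    finally have main: "(\<Sum>k<N. \<Sum>n<N. c n * (e k * w) ^ n) = f z0 * N" .
    have "(\<Sum>k<N. f (z0 + e k * w)) - f z0 * N = (\<Sum>k<N. \<Sum>n. c (n + N) * (e k * w) ^ (n + N))"
      unfolding split sum.distrib main by simp
    also have "norm \<dots> \<le> (\<Sum>k<N. t N)"
      using tail by (intro sum_norm_le) auto
    finally have *: "norm ((\<Sum>k<N. f (z0 + e k * w)) - f z0 * N) \<le> N * t N" by simp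
    have "(\<Sum>k<N. f (z0 + e k * w)) / N - f z0 = ((\<Sum>k<N. f (z0 + e k * w)) - f z0 * N) / N"
      using N by (simp add: diff_divide_distrib)
    then have "norm ((\<Sum>k<N. f (z0 + e k * w)) / N - f z0) = norm ((\<Sum>k<N. f (z0 + e k * w)) - f z0 * N) / N"
      by (simp add: norm_divide)
    also have "\<dots> \<le> t N" using * N by (simp add: field_simps)
    finally show ?thesis by (simp add: e_def)
  qed
  show ?thesis
    by (rule LIM_zero_cancel, rule Lim_null_comparison[OF _ t])
       (use bound in \<open>auto intro: eventually_mono[OF eventually_gt_at_top[of 0]]\<close>)
qed

text \<open>Averaging over \<open>N\<close> rotations about \<open>z0\<close> leaves the integral unchanged; then let \<open>N\<close> tend to
  infinity and apply Fatou's lemma.\<close>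

lemma powr_sub_mean_value:
  assumes f: "f holomorphic_on ball z0 r" and p: "1 \<le> p" and "0 < r"
  shows "ennreal (norm (f z0) powr p) * emeasure lborel (ball z0 r)
    \<le> (\<integral>\<^sup>+ z. ennreal (norm (f z) powr p) * indicator (ball z0 r) z \<partial>lborel)"
proof -
  \<comment> \<open>Cutting \<open>f\<close> off outside the disk gives a function that is Borel on
    the whole plane, so rotations and translations of the full plane apply to it.\<close>
  define g where "g = (\<lambda>z. indicator (ball z0 r) z *\<^sub>R f z)"
  have g [measurable]: "g \<in> borel_measurable borel"
    unfolding g_def using holomorphic_on_imp_continuous_on[OF f]
    by (intro borel_measurable_continuous_on_indicator) auto
  define F where "F = (\<lambda>w. ennreal (norm (g (z0 + w)) powr p))"
  have F [measurable]: "F \<in> borel_measurable borel"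
    unfolding F_def by measurable
  define e where "e = (\<lambda>(N::nat) (k::nat). cis (2 * pi * k / N))"
  have ne: "norm (e N k) = 1" for N k by (simp add: e_def)
  define h where "h = (\<lambda>N w. ennreal (1 / real N) * (\<Sum>k<N. F (e N k * w)))"
  have h [measurable]: "h N \<in> borel_measurable borel" for N
    unfolding h_def by measurable
  have inth: "(\<integral>\<^sup>+ w. h N w \<partial>lborel) = (\<integral>\<^sup>+ w. F w \<partial>lborel)" if N: "N > 0" for N
  proof -
    have "(\<integral>\<^sup>+ w. h N w \<partial>lborel) = ennreal (1 / real N) * (\<Sum>k<N. \<integral>\<^sup>+ w. F (e N k * w) \<partial>lborel)"
      unfolding h_def by (subst nn_integral_cmult) (auto simp: nn_integral_sum)
    also have "(\<Sum>k<N. \<integral>\<^sup>+ w. F (e N k * w) \<partial>lborel) = ennreal (real N) * (\<integral>\<^sup>+ w. F w \<partial>lborel)"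
      using nn_integral_lborel_rotation[OF ne F] by (simp add: ennreal_of_nat_eq_real_of_nat)
    also have "ennreal (1 / real N) * \<dots> = (\<integral>\<^sup>+ w. F w \<partial>lborel)"
      using N by (simp add: mult.assoc[symmetric] ennreal_mult[symmetric])
    finally show ?thesis .
  qed
  \<comment> \<open>The pointwise bound for Fatou's lemma: by Jensen's inequality
    \<open>h N w\<close> dominates the power of the modulus of the mean, and these means converge to
    \<open>f z0\<close>.\<close>
  have low: "ennreal (norm (f z0) powr p) * indicator (ball 0 r) w \<le> liminf (\<lambda>N. h N w)" for w
  proof (cases "w \<in> ball 0 r")
    case True
    then have w: "norm w < r" by simp
    define m where "m = (\<lambda>N. (\<Sum>k<N. f (z0 + e N k * w)) / of_nat N)"
    have "m \<longlonglongrightarrow> f z0"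
      unfolding m_def e_def by (rule tendsto_mean_rotations[OF f w])
    then have "(\<lambda>N. ennreal (norm (m N) powr p)) \<longlonglongrightarrow> ennreal (norm (f z0) powr p)"
      using p by (intro tendsto_ennrealI tendsto_powr' tendsto_norm tendsto_const) auto
    then have "ennreal (norm (f z0) powr p) = liminf (\<lambda>N. ennreal (norm (m N) powr p))"
      by (intro lim_imp_Liminf[symmetric]) auto
    also have "\<dots> \<le> liminf (\<lambda>N. h N w)"
    proof (intro Liminf_mono eventually_mono[OF eventually_gt_at_top[of 0]])
      fix N :: nat assume N: "0 < N"
      have g: "g (z0 + e N k * w) = f (z0 + e N k * w)" for k
        using w by (auto simp: g_def indicator_def dist_norm norm_mult ne)
      have "norm (m N) \<le> (\<Sum>k<N. norm (f (z0 + e N k * w))) / N"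
        unfolding m_def norm_divide by (auto intro!: divide_right_mono norm_sum)
      then have "norm (m N) powr p \<le> ((\<Sum>k<N. norm (f (z0 + e N k * w))) / N) powr p"
        using p by (intro powr_mono2) auto
      also have "\<dots> \<le> (\<Sum>k<N. norm (f (z0 + e N k * w)) powr p) / N"
        by (rule powr_mean_le[OF p N]) auto
      finally have "ennreal (norm (m N) powr p) \<le> ennreal ((1 / real N) * (\<Sum>k<N. norm (f (z0 + e N k * w)) powr p))"
        by (simp add: ennreal_leI)
      also have "\<dots> = h N w"
        unfolding h_def F_def g by (subst ennreal_mult) (auto intro!: sum_nonneg simp: sum_ennreal)
      finally show "ennreal (norm (m N) powr p) \<le> h N w" .
    qed
    finally show ?thesis using True by simp
  qed auto
  have "ennreal (norm (f z0) powr p) * emeasure lborel (ball z0 r)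
    = ennreal (norm (f z0) powr p) * emeasure lborel (ball (0::complex) r)"
    using \<open>0 < r\<close> by (simp add: emeasure_lborel_ball_complex)
  also have "\<dots> = (\<integral>\<^sup>+ w. ennreal (norm (f z0) powr p) * indicator (ball (0::complex) r) w \<partial>lborel)"
    by (subst nn_integral_cmult_indicator) auto
  also have "\<dots> \<le> (\<integral>\<^sup>+ w. liminf (\<lambda>N. h N w) \<partial>lborel)"
    by (intro nn_integral_mono low)
  also have "\<dots> \<le> liminf (\<lambda>N. \<integral>\<^sup>+ w. h N w \<partial>lborel)"
    by (rule nn_integral_liminf) measurable
  also have "\<dots> = liminf (\<lambda>N. \<integral>\<^sup>+ w. F w \<partial>lborel)"
    by (intro Liminf_eq eventually_mono[OF eventually_gt_at_top[of 0]] inth)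
  also have "\<dots> = (\<integral>\<^sup>+ w. F w \<partial>lborel)"
    by (simp add: Liminf_const)
  also have "\<dots> = (\<integral>\<^sup>+ w. ennreal (norm (g (w + z0)) powr p) \<partial>lborel)"
    by (simp add: F_def add.commute)
  also have "\<dots> = (\<integral>\<^sup>+ w. ennreal (norm (g w) powr p) \<partial>lborel)"
    by (rule nn_integral_lborel_shift[where f = "\<lambda>w. ennreal (norm (g w) powr p)"]) measurable
  also have "\<dots> = (\<integral>\<^sup>+ z. ennreal (norm (f z) powr p) * indicator (ball z0 r) z \<partial>lborel)"
    by (intro nn_integral_cong) (auto simp: g_def indicator_def)
  finally show ?thesis .
qed

section \<open>Regular weights\<close>

text \<open>Regularity with denominators cleared and the inequalities made non-strict. One constant,
  at least 1, serves both directions.\<close>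

locale regular_weight =
  fixes \<omega> :: "complex \<Rightarrow> real" and C :: real
  assumes weight: "weight \<omega>" and C1: "1 \<le> C"
    and tail_le: "\<And>r. 0 < r \<Longrightarrow> r < 1 \<Longrightarrow> weight_tail \<omega> r \<le> C * ((1 - r) * \<omega> (of_real r))"
    and le_tail: "\<And>r. 0 < r \<Longrightarrow> r < 1 \<Longrightarrow> (1 - r) * \<omega> (of_real r) \<le> C * weight_tail \<omega> r"

lemma regular_weights_obtain:
  assumes "\<omega> \<in> regular_weights"
  obtains C where "regular_weight \<omega> C"
proof -
  have w: "weight \<omega>" and "\<exists>C>0. \<forall>r. 0 < r \<and> r < 1 \<longrightarrow>
        1 / C < weight_tail \<omega> r / ((1 - r) * \<omega> (of_real r)) \<and>
        weight_tail \<omega> r / ((1 - r) * \<omega> (of_real r)) < C"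
    using assms unfolding regular_weights_def by blast+
  then obtain C where C: "C > 0"
    and *: "\<And>r. 0 < r \<Longrightarrow> r < 1 \<Longrightarrow> 1 / C < weight_tail \<omega> r / ((1 - r) * \<omega> (of_real r)) \<and>
        weight_tail \<omega> r / ((1 - r) * \<omega> (of_real r)) < C"
    by blast
  define D where "D = max 1 C"
  have D: "1 \<le> D" "C \<le> D" by (auto simp: D_def)
  have "regular_weight \<omega> D"
  proof
    show "weight \<omega>" by (rule w)
    show "1 \<le> D" by (rule D)
  next
    fix r :: real assume r: "0 < r" "r < 1"
    define b where "b = (1 - r) * \<omega> (of_real r)"
    define t where "t = weight_tail \<omega> r"
    have "complex_of_real r \<in> unit_disk" using r by simp
    then have "0 < \<omega> (of_real r)" using w unfolding weight_def by blast
    then have b: "0 < b" using r by (simp add: b_def)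
    have "1 / C < t / b" "t / b < C"
      using *[OF r] unfolding b_def t_def by blast+
    then have l: "t < C * b" "b < C * t"
      using C b by (simp_all add: pos_divide_less_eq pos_less_divide_eq mult.commute)
    \<comment> \<open>Positivity of the tail, which allows \<open>C\<close> to be replaced by the
      larger \<open>D\<close> in both estimates.\<close>
    have "0 < C * t" using l(2) b by (rule less_trans[rotated])
    then have "0 < t" using C by (simp add: zero_less_mult_iff)
    then have "C * t \<le> D * t" using D by (intro mult_right_mono) auto
    moreover have "C * b \<le> D * b" using D b by (intro mult_right_mono) auto
    ultimately have "t \<le> D * b" "b \<le> D * t" using l by linarith+
    then show "weight_tail \<omega> r \<le> D * ((1 - r) * \<omega> (of_real r))"
      "(1 - r) * \<omega> (of_real r) \<le> D * weight_tail \<omega> r"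
      unfolding b_def t_def by this+
  qed
  then show thesis by (rule that)
qed

context regular_weight
begin

abbreviation "T \<equiv> weight_tail \<omega>"

lemma weight_pos: "norm z < 1 \<Longrightarrow> 0 < \<omega> z"
  and weight_radial: "norm z < 1 \<Longrightarrow> \<omega> z = \<omega> (of_real (norm z))"
  using weight unfolding weight_def mem_ball_0 Ball_def by blast+

lemma weight_pos_real: "0 \<le> s \<Longrightarrow> s < 1 \<Longrightarrow> 0 < \<omega> (of_real s)"
  by (rule weight_pos) simp

lemma weight_set_integrable:
  assumes "A \<subseteq> {0<..<1}" "A \<in> sets lebesgue"
  shows "set_integrable lebesgue A (\<lambda>s. \<omega> (of_real s))"
  using weight assms unfolding weight_def by (blast intro: set_integrable_subset)

lemma tail_split:
  assumes "0 \<le> r" "r \<le> t" "t < 1"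
  shows "T r = set_lebesgue_integral lebesgue {r<..t} (\<lambda>s. \<omega> (of_real s)) + T t"
proof -
  have "{r<..<1} = {r<..t} \<union> {t<..<1}" using assms by auto
  then show ?thesis unfolding weight_tail_def
    by (simp, intro set_integral_Un weight_set_integrable) (use assms in auto)
qed

lemma tail_zero: "1 \<le> r \<Longrightarrow> T r = 0"
  by (simp add: weight_tail_def set_lebesgue_integral_def)

lemma tail_nonneg: assumes "0 \<le> r" shows "0 \<le> T r"
  unfolding weight_tail_def set_lebesgue_integral_def
proof (rule Bochner_Integration.integral_nonneg)
  fix s show "0 \<le> indicat_real {r<..<1} s *\<^sub>R \<omega> (complex_of_real s)"
    using weight_pos_real[of s] assms by (auto simp: indicator_def)
qed

lemma tail_antimono: assumes "0 \<le> r" "r \<le> t" shows "T t \<le> T r"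
proof (cases "t < 1")
  case True
  have "0 \<le> set_lebesgue_integral lebesgue {r<..t} (\<lambda>s. \<omega> (of_real s))"
    unfolding set_lebesgue_integral_def
  proof (rule Bochner_Integration.integral_nonneg)
    fix s show "0 \<le> indicat_real {r<..t} s *\<^sub>R \<omega> (complex_of_real s)"
      using weight_pos_real[of s] assms True by (auto simp: indicator_def)
  qed
  then show ?thesis using tail_split[of r t] assms True by simp
qed (use tail_nonneg[of r] assms in \<open>auto simp: tail_zero\<close>)

text \<open>Regularity holds at positive radii only. Applying it at the midpoint of \<open>r\<close>
  and 1 includes the case \<open>r = 0\<close>.\<close>

lemma tail_pos: assumes "0 \<le> r" "r < 1" shows "0 < T r"
proof -
  have "T ((r+1)/2) \<le> T r" using assms by (intro tail_antimono) auto
  moreover have "0 < (1 - (r+1)/2) * \<omega> (of_real ((r+1)/2))"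
    using assms by (intro mult_pos_pos weight_pos_real) auto
  then have "0 < C * T ((r+1)/2)" using le_tail[of "(r+1)/2"] assms by auto
  then have "0 < T ((r+1)/2)" using C1 by (simp add: zero_less_mult_iff)
  ultimately show ?thesis by linarith
qed

text \<open>On \<open>{r<..t}\<close> the weight is at most \<open>C * T r / (1 - t)\<close>. The
  endpoint \<open>t\<close> is chosen so that \<open>(t - r) * C / (1 - t) = 1 / 2\<close>; hence
  this interval carries at most half of \<open>T r\<close>, and the rest is
  \<open>T t\<close>.\<close>

lemma tail_halving:
  assumes "0 \<le> r" "r < 1"
  shows "T r \<le> 2 * T (r + (1 - r) / (2 * C + 1))"
proof -
  define t where "t = r + (1 - r) / (2 * C + 1)"
  have t: "r < t" using assms C1 by (simp add: t_def)
  have t1: "1 - t = (1 - r) * (2 * C / (2 * C + 1))" using C1 by (simp add: t_def field_simps)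
  then have "0 < 1 - t" using assms C1 by simp
  then have t2: "t < 1" by simp
  have "e / k * (C / (e * (2 * C / k))) = 1 / 2" if "0 < e" "0 < k" for e k
    using that C1 by simp
  from this[of "1 - r" "2 * C + 1"] have ratio: "(t - r) * (C / (1 - t)) = 1 / 2"
    unfolding t1 using assms C1 by (simp add: t_def)
  have "set_lebesgue_integral lebesgue {r<..t} (\<lambda>s. \<omega> (of_real s))
      \<le> set_lebesgue_integral lebesgue {r<..t} (\<lambda>s. C * T r / (1 - t))"
  proof (rule set_integral_mono)
    show "set_integrable lebesgue {r<..t} (\<lambda>s. \<omega> (of_real s))"
      using assms t2 by (intro weight_set_integrable) auto
    show "set_integrable lebesgue {r<..t} (\<lambda>s. C * T r / (1 - t))"
      unfolding set_integrable_def by (intro integrable_scaleR_left integrable_real_indicator) (auto simp: t less_imp_le)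
    fix s assume s: "s \<in> {r<..t}"
    have "\<omega> (of_real s) \<le> C * T s / (1 - s)"
      using le_tail[of s] s assms t2 by (simp add: field_simps)
    also have "\<dots> \<le> C * T r / (1 - t)"
      using s assms t2 C1 tail_antimono[of r s] tail_nonneg[of r] by (intro frac_le mult_left_mono) auto
    finally show "\<omega> (of_real s) \<le> C * T r / (1 - t)" .
  qed
  also have "\<dots> = (t - r) * (C * T r / (1 - t))"
    using t by (subst set_integral_const) auto
  also have "\<dots> = T r * ((t - r) * (C / (1 - t)))" by simp
  also have "\<dots> = T r / 2" unfolding ratio by simp
  finally show ?thesis using tail_split[of r t] assms t t2 by (simp add: t_def)
qed

text \<open>Each use of \<open>tail_halving\<close> shrinks the distance to the circle by \<theta>
  and costs a factor 2. The number of uses that brings it below one half depends on \<open>C\<close>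
  alone.\<close>

lemma tail_doubling_ex:
  obtains A where "1 \<le> A" "\<And>\<rho>. 0 < \<rho> \<Longrightarrow> \<rho> \<le> 1 \<Longrightarrow> T (1 - \<rho>) \<le> A * T (1 - \<rho> / 2)"
proof -
  define \<theta> where "\<theta> = 1 - 1 / (2 * C + 1)"
  have \<theta>: "0 < \<theta>" "\<theta> < 1" using C1 by (auto simp: \<theta>_def field_simps)
  have step: "1 - x + (1 - (1 - x)) / (2 * C + 1) = 1 - \<theta> * x" for x
    by (simp add: \<theta>_def algebra_simps)
  have it: "T (1 - \<rho>) \<le> 2 ^ j * T (1 - \<theta> ^ j * \<rho>)" if "0 < \<rho>" "\<rho> \<le> 1" for \<rho> j
  proof (induction j)
    case (Suc j)
    have l: "0 < \<theta> ^ j * \<rho>" "\<theta> ^ j * \<rho> \<le> 1"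
      using that \<theta> by (auto intro!: mult_le_one power_le_one)
    have "T (1 - \<theta> ^ j * \<rho>) \<le> 2 * T (1 - \<theta> ^ j * \<rho> + (1 - (1 - \<theta> ^ j * \<rho>)) / (2 * C + 1))"
      using l by (intro tail_halving) auto
    also have "1 - \<theta> ^ j * \<rho> + (1 - (1 - \<theta> ^ j * \<rho>)) / (2 * C + 1) = 1 - \<theta> ^ Suc j * \<rho>"
      using step[of "\<theta> ^ j * \<rho>"] by (simp add: mult.assoc)
    finally have "2 ^ j * T (1 - \<theta> ^ j * \<rho>) \<le> 2 ^ j * (2 * T (1 - \<theta> ^ Suc j * \<rho>))"
      by (intro mult_left_mono) auto
    from order_trans[OF Suc this] show ?case by (simp add: mult_ac)
  qed simp
  obtain j where j: "\<theta> ^ j < 1 / 2" using real_arch_pow_inv[of "1/2" \<theta>] \<theta> by auto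
  show thesis
  proof (rule that[of "2 ^ j"])
    fix \<rho> :: real assume \<rho>: "0 < \<rho>" "\<rho> \<le> 1"
    have "\<theta> ^ j * \<rho> \<le> 1/2 * \<rho>" using j \<rho> by (intro mult_right_mono) auto
    then have "T (1 - \<theta> ^ j * \<rho>) \<le> T (1 - \<rho> / 2)"
      using \<rho> by (intro tail_antimono) auto
    then show "T (1 - \<rho>) \<le> 2 ^ j * T (1 - \<rho> / 2)"
      using it[OF \<rho>, of j] by (meson mult_left_mono order_trans zero_le_numeral zero_le_power)
  qed auto
qed

text \<open>Choosing the doubling constant once and for all lets later statements mention it, as in
  the condition \<open>4 * A \<le> 2 ^ m\<close> on the kernel exponent.\<close>

definition A where "A = (SOME A. 1 \<le> A \<and> (\<forall>\<rho>. 0 < \<rho> \<longrightarrow> \<rho> \<le> 1 \<longrightarrow> T (1 - \<rho>) \<le> A * T (1 - \<rho> / 2)))"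

lemma A: "1 \<le> A" "0 < \<rho> \<Longrightarrow> \<rho> \<le> 1 \<Longrightarrow> T (1 - \<rho>) \<le> A * T (1 - \<rho> / 2)"
proof -
  have "\<exists>A. 1 \<le> A \<and> (\<forall>\<rho>. 0 < \<rho> \<longrightarrow> \<rho> \<le> 1 \<longrightarrow> T (1 - \<rho>) \<le> A * T (1 - \<rho> / 2))"
    using tail_doubling_ex by blast
  from someI_ex[OF this] show "1 \<le> A" "0 < \<rho> \<Longrightarrow> \<rho> \<le> 1 \<Longrightarrow> T (1 - \<rho>) \<le> A * T (1 - \<rho> / 2)"
    unfolding A_def by auto
qed

lemma tail_doubling_iterate:
  assumes "0 < \<delta>" "\<delta> \<le> 1"
  shows "T (max 0 (1 - 2 ^ k * \<delta>)) \<le> A ^ k * T (1 - \<delta>)"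
proof (induction k)
  case (Suc k)
  \<comment> \<open>The cap at 1 keeps the doubling inequality applicable once
    \<open>2 ^ Suc k * \<delta>\<close> exceeds 1; in either case
    \<open>\<sigma> / 2 \<le> 2 ^ k * \<delta>\<close>.\<close>
  define \<sigma> where "\<sigma> = min 1 (2 ^ Suc k * \<delta>)"
  have \<sigma>: "0 < \<sigma>" "\<sigma> \<le> 1" using assms by (auto simp: \<sigma>_def)
  have "T (max 0 (1 - 2 ^ Suc k * \<delta>)) = T (1 - \<sigma>)"
    unfolding \<sigma>_def by (intro arg_cong[where f = T]) (auto simp: max_def min_def)
  also have "\<dots> \<le> A * T (1 - \<sigma> / 2)" by (rule A(2)[OF \<sigma>])
  also have "\<dots> \<le> A * T (max 0 (1 - 2 ^ k * \<delta>))"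
    using A(1) \<sigma> by (intro mult_left_mono tail_antimono) (auto simp: \<sigma>_def)
  also have "\<dots> \<le> A * (A ^ k * T (1 - \<delta>))"
    using A(1) Suc by (intro mult_left_mono) auto
  finally show ?case by (simp add: mult.assoc)
qed (use assms in auto)

text \<open>The weight itself is only Lebesgue measurable along the radius. The comparable
  function \<open>W\<close> is Borel measurable because \<open>T\<close> is monotone.\<close>

definition W :: "real \<Rightarrow> real" where "W r = T (max 0 r) / (1 - r)"

lemma W_measurable [measurable]: "W \<in> borel_measurable borel"
proof -
  have "mono (\<lambda>r. - T (max 0 r))"
    by (intro monoI) (auto intro!: tail_antimono)
  then have "(\<lambda>r. - T (max 0 r)) \<in> borel_measurable borel" by (rule borel_measurable_mono)
  then have [measurable]: "(\<lambda>r. T (max 0 r)) \<in> borel_measurable borel" by simp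
  show ?thesis unfolding W_def by measurable
qed

lemma W_nonneg: "r < 1 \<Longrightarrow> 0 \<le> W r"
  by (simp add: W_def tail_nonneg)

lemma weight_le_W: "0 < r \<Longrightarrow> r < 1 \<Longrightarrow> \<omega> (of_real r) \<le> C * W r"
  using le_tail[of r] by (simp add: W_def field_simps)

lemma W_le_weight: "0 < r \<Longrightarrow> r < 1 \<Longrightarrow> W r \<le> C * \<omega> (of_real r)"
  using tail_le[of r] by (simp add: W_def field_simps)

lemma nn_integral_weight_tail:
  assumes "0 \<le> r" "0 \<le> c"
  shows "(\<integral>\<^sup>+ s. ennreal (c * indicator {r<..<1} s * \<omega> (of_real s)) \<partial>lebesgue) = ennreal (c * T r)"
proof -
  have i: "set_integrable lebesgue {r<..<1} (\<lambda>s. \<omega> (of_real s))"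
    using assms by (intro weight_set_integrable) auto
  then have i': "integrable lebesgue (\<lambda>s. c * indicator {r<..<1} s * \<omega> (of_real s))"
    unfolding set_integrable_def by (simp add: mult.assoc)
  have "(\<integral>\<^sup>+ s. ennreal (c * indicator {r<..<1} s * \<omega> (of_real s)) \<partial>lebesgue)
    = ennreal (\<integral> s. c * indicator {r<..<1} s * \<omega> (of_real s) \<partial>lebesgue)"
    using assms weight_pos_real by (intro nn_integral_eq_integral[OF i'] AE_I2) (auto simp: indicator_def less_imp_le)
  also have "(\<integral> s. c * indicator {r<..<1} s * \<omega> (of_real s) \<partial>lebesgue) = c * T r"
    unfolding weight_tail_def set_lebesgue_integral_def by (simp add: mult.assoc)
  finally show ?thesis .
qed

text \<open>The total mass that the disjoint rotated copies of a box have to share. For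
  \<open>\<rho> > 1\<close> it is the mass of the whole disk, hence the \<open>max 0\<close> in the
  bound for it.\<close>

definition H :: "real \<Rightarrow> ennreal" where
  "H \<rho> = (\<integral>\<^sup>+ z. ennreal (W (norm z)) * indicator {z \<in> unit_disk. 1 - \<rho> < norm (z::complex)} z \<partial>lborel)"

text \<open>In polar coordinates the factor \<open>r\<close> is at most 1 and \<open>W\<close> is at
  most \<open>C\<close> times the weight, so the radial integral returns to the tail. The weight
  enters only after the passage from \<open>lborel\<close> to \<open>lebesgue\<close>.\<close>

lemma H_le: "H \<rho> \<le> ennreal (2 * pi * C * T (max 0 (1 - \<rho>)))"
proof -
  define g where "g = (\<lambda>r. ennreal (W r) * indicator {1 - \<rho><..} r)"
  have [measurable]: "g \<in> borel_measurable borel" unfolding g_def by measurable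
  have "H \<rho> = (\<integral>\<^sup>+ z. g (norm z) * indicator unit_disk z \<partial>(lborel :: complex measure))"
    unfolding H_def g_def by (intro nn_integral_cong) (auto simp: indicator_def)
  also have "\<dots> = (\<integral>\<^sup>+ r. ennreal (2 * pi * r) * g r * indicator {0<..<1} r \<partial>lborel)"
    by (rule nn_integral_radial) measurable
  also have "\<dots> = (\<integral>\<^sup>+ r. ennreal (2 * pi * r) * g r * indicator {0<..<1} r \<partial>lebesgue)"
    by (simp add: nn_integral_completion)
  also have "\<dots> \<le> (\<integral>\<^sup>+ s. ennreal (2 * pi * C * indicator {max 0 (1 - \<rho>)<..<1} s * \<omega> (of_real s)) \<partial>lebesgue)"
  proof (intro nn_integral_mono)
    fix s :: real
    show "ennreal (2 * pi * s) * g s * indicator {0<..<1} s \<le> ennreal (2 * pi * C * indicator {max 0 (1 - \<rho>)<..<1} s * \<omega> (of_real s))"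
    proof (cases "s \<in> {max 0 (1 - \<rho>)<..<1}")
      case True
      then have s: "0 < s" "s < 1" "1 - \<rho> < s" by auto
      have "2 * pi * s * W s \<le> 2 * pi * 1 * (C * \<omega> (of_real s))"
        using s W_le_weight[of s] W_nonneg[of s] by (intro mult_mono) auto
      then show ?thesis using s by (simp add: g_def ennreal_mult[symmetric] W_nonneg ennreal_leI algebra_simps)
    qed (auto simp: g_def indicator_def)
  qed
  also have "\<dots> = ennreal (2 * pi * C * T (max 0 (1 - \<rho>)))"
    using C1 by (intro nn_integral_weight_tail) auto
  finally show ?thesis .
qed

end

section \<open>Separation of the roots of unity\<close>

text \<open>The derivative \<open>cos x - 1 / 2\<close> of the difference is nonnegative up to
  \<open>pi / 3\<close>, the largest value of \<open>pi / N\<close> for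
  \<open>3 \<le> N\<close>.\<close>

lemma sin_ge_half:
  assumes "0 \<le> y" "y \<le> pi / 3"
  shows "y / 2 \<le> sin y"
proof -
  have "sin 0 - 0 / 2 \<le> sin y - y / 2"
  proof (rule DERIV_nonneg_imp_nondecreasing[OF assms(1)])
    fix x assume x: "0 \<le> x" "x \<le> y"
    have "cos (pi / 3) \<le> cos x"
      using x assms by (intro cos_monotone_0_pi_le) auto
    then have "0 \<le> cos x - 1 / 2" by (simp add: cos_60)
    moreover have "((\<lambda>x. sin x - x / 2) has_real_derivative cos x - 1 / 2) (at x)"
      by (auto intro!: derivative_eq_intros)
    ultimately show "\<exists>d. ((\<lambda>x. sin x - x / 2) has_real_derivative d) (at x) \<and> 0 \<le> d" by blast
  qed
  then show ?thesis by simp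
qed

lemma norm_cis_diff: "norm (cis a - cis b) = 2 * \<bar>sin ((a - b) / 2)\<bar>"
proof -
  define x where "x = (a - b) / 2"
  define y where "y = (a + b) / 2"
  have "cis a - cis b = cis y * (cis x - cis (- x))"
    by (simp add: right_diff_distrib cis_mult x_def y_def) (simp add: field_simps)
  also have "cis x - cis (- x) = 2 * \<i> * of_real (sin x)"
    by (simp add: complex_eq_iff)
  finally show ?thesis by (simp add: norm_mult x_def)
qed

text \<open>Half the angular difference lies between \<open>pi / N\<close> and
  \<open>pi - pi / N\<close>, where the sine is at least \<open>sin (pi / N)\<close> and so at least
  half of \<open>pi / N\<close>. The chord is twice the sine, and \<open>3 < pi\<close>.\<close>

lemma roots_of_unity_separated:
  fixes N :: nat
  assumes "3 \<le> N" "j < k" "k < N"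
  shows "3 / N \<le> norm (cis (2 * pi * real k / N) - cis (2 * pi * real j / N))"
proof -
  define x where "x = pi * (real k - real j) / N"
  have N: "0 < real N" using assms by simp
  have lo: "pi / N \<le> x" unfolding x_def using assms by (intro divide_right_mono) auto
  have "x \<le> pi * (real N - 1) / N" unfolding x_def using assms by (intro divide_right_mono mult_left_mono) auto
  also have "\<dots> = pi - pi / N" using N by (simp add: field_simps)
  finally have hi: "x \<le> pi - pi / N" .
  have p0: "0 \<le> pi / N" by simp
  have p3: "pi / N \<le> pi / 3" using assms by (intro divide_left_mono) auto
  have "sin (pi / N) \<le> sin x"
  proof (cases "x \<le> pi / 2")
    case True
    then show ?thesis using lo p0 by (intro sin_monotone_2pi_le) linarith+
  next
    case False
    then have "sin (pi / N) \<le> sin (pi - x)" using hi p0 by (intro sin_monotone_2pi_le) linarith+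
    then show ?thesis by simp
  qed
  with sin_ge_half[OF p0 p3] have "pi / N / 2 \<le> sin x" by (rule order_trans)
  then have "pi / N \<le> 2 * \<bar>sin x\<bar>" by (simp add: abs_if)
  moreover have "3 / N \<le> pi / N" using N pi_gt3 by (intro divide_right_mono) auto
  moreover have "(2 * pi * real k / N - 2 * pi * real j / N) / 2 = x"
    by (simp add: x_def right_diff_distrib diff_divide_distrib)
  ultimately show ?thesis by (simp add: norm_cis_diff)
qed

context regular_weight
begin

text \<open>About \<open>1 / \<rho>\<close> rotated copies of the Carleson box fit disjointly into the annulus.\<close>

lemma Carleson_box:
  assumes \<xi>: "norm \<xi> = 1" and \<rho>: "0 < \<rho>"
  shows "(\<integral>\<^sup>+ z. ennreal (W (norm z)) * indicator (unit_disk \<inter> ball \<xi> \<rho>) z \<partial>lborel) \<le> ennreal (3 * \<rho>) * H \<rho>"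
proof -
  define S where "S = unit_disk \<inter> ball \<xi> \<rho>"
  define I where "I = (\<integral>\<^sup>+ z. ennreal (W (norm z)) * indicator S z \<partial>lborel)"
  have Ssub: "S \<subseteq> {z \<in> unit_disk. 1 - \<rho> < norm z}"
  proof
    fix z assume "z \<in> S"
    then have "norm z < 1" "norm (\<xi> - z) < \<rho>" by (auto simp: S_def dist_norm)
    moreover have "norm \<xi> - norm z \<le> norm (\<xi> - z)" by (rule norm_triangle_ineq2)
    ultimately show "z \<in> {z \<in> unit_disk. 1 - \<rho> < norm z}" using \<xi> by auto
  qed
  have "I \<le> H \<rho>"
    unfolding I_def H_def using Ssub by (intro nn_integral_mono) (auto simp: indicator_def)
  have "I \<le> ennreal (3 * \<rho>) * H \<rho>"
  proof (cases "1 / 3 < \<rho>")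
    \<comment> \<open>For a wide box the factor \<open>3 * \<rho>\<close> exceeds 1, and the mass of
      the annulus is already a sufficient bound.\<close>
    case True
    then have "1 * H \<rho> \<le> ennreal (3 * \<rho>) * H \<rho>" by (intro mult_right_mono) auto
    with \<open>I \<le> H \<rho>\<close> show ?thesis by simp
  next
    case False
    \<comment> \<open>Two requirements balance here: \<open>3 * \<rho> \<le> 3 / N\<close> makes the
      rotated boxes disjoint, and \<open>1 / N \<le> 3 * \<rho>\<close> gives the factor in the
      conclusion.\<close>
    define N where "N = nat \<lfloor>1 / \<rho>\<rfloor>"
    have "3 \<le> 1 / \<rho>" using False \<rho> by (simp add: field_simps)
    then have "3 \<le> \<lfloor>1 / \<rho>\<rfloor>" by linarith
    then have N3: "3 \<le> N" and rN: "real N = of_int \<lfloor>1 / \<rho>\<rfloor>" unfolding N_def by linarith+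
    have N1: "real N \<le> 1 / \<rho>" "1 / \<rho> - 1 < real N" unfolding rN by linarith+
    then have N2: "1 / real N \<le> 3 * \<rho>" "3 * \<rho> \<le> 3 / real N"
      using N3 \<rho> \<open>3 \<le> 1 / \<rho>\<close> by (auto simp: field_simps)
    define e where "e = (\<lambda>k. cis (2 * pi * real k / N))"
    have ne: "norm (e k) = 1" for k by (simp add: e_def)
    have S [measurable]: "S \<in> sets borel" by (simp add: S_def)
    define R where "R = {z \<in> unit_disk. 1 - \<rho> < norm (z::complex)}"
    \<comment> \<open>Two points of the box are less than \<open>2 * \<rho>\<close> apart, whereas
      the two rotations of \<open>z\<close> differ by at least \<open>3 * \<rho>\<close> times
      \<open>norm z\<close>, and \<open>norm z\<close> is at least 2/3.\<close>
    have sep: "\<not> (e j * z \<in> S \<and> e k * z \<in> S)" if "j < k" "k < N" for j k z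
    proof
      assume zS: "e j * z \<in> S \<and> e k * z \<in> S"
      then have "e j * z \<in> R" using Ssub by (auto simp: R_def)
      then have "1 - \<rho> < norm z" by (auto simp: R_def norm_mult ne)
      then have z: "2 / 3 \<le> norm z" using False by linarith
      have "dist (e k * z) (e j * z) < \<rho> + \<rho>"
        using zS by (intro dist_triangle_less_add[of _ \<xi>]) (auto simp: S_def dist_commute)
      moreover have "dist (e k * z) (e j * z) = norm (e k - e j) * norm z"
        by (simp add: dist_norm norm_mult flip: left_diff_distrib)
      moreover have "3 * \<rho> \<le> norm (e k - e j)"
        using roots_of_unity_separated[OF N3 that] N2(2) unfolding e_def by linarith
      then have "3 * \<rho> * (2 / 3) \<le> norm (e k - e j) * norm z"
        using z \<rho> by (intro mult_mono) auto
      ultimately show False by linarith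
    qed
    have le1: "(\<Sum>k<N. indicator S (e k * z)) \<le> (indicator R z :: ennreal)" for z
    proof (cases "\<exists>k<N. e k * z \<in> S")
      case True
      then obtain k where k: "k < N" "e k * z \<in> S" by auto
      have "(\<Sum>j<N. indicator S (e j * z)) = (\<Sum>j<N. if j = k then 1 else 0 :: ennreal)"
      proof (intro sum.cong refl)
        fix j assume "j \<in> {..<N}"
        then show "indicator S (e j * z) = (if j = k then 1 else 0 :: ennreal)"
          using k sep[of j k z] sep[of k j z] by (cases j k rule: linorder_cases) auto
      qed
      also have "\<dots> = 1" using k by simp
      also have "\<dots> = indicator R z"
        using k Ssub by (auto simp: R_def norm_mult ne)
      finally show ?thesis by simp
    qed auto
    have "of_nat N * I = (\<Sum>k<N. \<integral>\<^sup>+ z. ennreal (W (norm z)) * indicator S (e k * z) \<partial>lborel)"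
    proof -
      have "(\<integral>\<^sup>+ z. ennreal (W (norm z)) * indicator S (e k * z) \<partial>lborel) = I" for k
        using nn_integral_lborel_rotation[OF ne, of "\<lambda>z. ennreal (W (norm z)) * indicator S z" k]
        by (simp add: I_def norm_mult ne)
      then show ?thesis by simp
    qed
    also have "\<dots> = (\<integral>\<^sup>+ z. ennreal (W (norm z)) * (\<Sum>k<N. indicator S (e k * z)) \<partial>lborel)"
      by (subst nn_integral_sum[symmetric]) (auto simp: sum_distrib_left)
    also have "\<dots> \<le> H \<rho>"
      unfolding H_def R_def[symmetric] by (intro nn_integral_mono mult_left_mono le1) auto
    finally have NI: "of_nat N * I \<le> H \<rho>" .
    have "I = ennreal (1 / real N) * (of_nat N * I)"
      using N3 by (simp add: mult.assoc[symmetric] ennreal_of_nat_eq_real_of_nat ennreal_mult[symmetric])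
    also have "\<dots> \<le> ennreal (3 * \<rho>) * H \<rho>"
      using N2 by (intro mult_mono NI ennreal_leI) auto
    finally show ?thesis .
  qed
  then show ?thesis by (simp add: I_def S_def)
qed

end

section \<open>Finite Blaschke products\<close>

text \<open>The identity behind the Schwarz-Pick lemma, kept free of division; it comes from
  expanding the squared moduli of \<open>1 - cnj a * z\<close> and \<open>z - a\<close>.\<close>

lemma one_minus_norm_Moebius:
  assumes "norm a < 1" "norm z < 1"
  shows "(1 - (norm (Moebius_function 0 a z))\<^sup>2) * (norm (1 - cnj a * z))\<^sup>2 = (1 - (norm a)\<^sup>2) * (1 - (norm z)\<^sup>2)"
proof -
  have nz: "1 - cnj a * z \<noteq> 0"
  proof
    assume "1 - cnj a * z = 0"
    then have "norm (cnj a * z) = 1" by simp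
    moreover have "norm (cnj a * z) < 1"
      using mult_strict_mono[of "norm a" 1 "norm z" 1] assms by (simp add: norm_mult)
    ultimately show False by simp
  qed
  have eq: "(norm (1 - cnj a * z))\<^sup>2 - (norm (z - a))\<^sup>2 = (1 - (norm a)\<^sup>2) * (1 - (norm z)\<^sup>2)"
    unfolding cmod_power2 by (simp add: algebra_simps power2_eq_square)
  have "(norm (Moebius_function 0 a z))\<^sup>2 * (norm (1 - cnj a * z))\<^sup>2 = (norm (z - a))\<^sup>2"
    using nz unfolding Moebius_function_simple by (simp flip: power_mult_distrib norm_mult)
  with eq show ?thesis by (simp add: left_diff_distrib)
qed

lemma norm_one_minus_cnj_mult:
  assumes "norm a < 1" "norm z \<le> 1"
  shows "1 - norm a \<le> norm (1 - cnj a * z)"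
proof -
  have "norm a * norm z \<le> norm a" using assms by (simp add: mult_left_le)
  moreover have "norm (1 - cnj a * z) \<ge> 1 - norm (cnj a * z)"
    using norm_triangle_ineq2[of 1 "cnj a * z"] by simp
  ultimately show ?thesis by (simp add: norm_mult)
qed

text \<open>In the Schwarz-Pick identity each factor \<open>1 + t\<close> lies between 1 and 2 and
  \<open>norm (1 - cnj a * z)\<close> lies between \<open>1 - norm a\<close> and 2. The constants
  collect these bounds: 4 from two such factors, 8 from one of them and a squared modulus.\<close>

lemma Moebius_boundary_distance:
  assumes a: "norm a < 1" and z: "norm z < 1"
  shows "1 - norm (Moebius_function 0 a z) \<le> 4 / (1 - norm a) * (1 - norm z)"
    and "(1 - norm a) / 8 * (1 - norm z) \<le> 1 - norm (Moebius_function 0 a z)"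
proof -
  define m where "m = norm (Moebius_function 0 a z)"
  define A where "A = norm a"
  define Z where "Z = norm z"
  define q where "q = (norm (1 - cnj a * z))"
  have m: "0 \<le> m" "m < 1" using Moebius_function_norm_lt_1[OF a z] by (auto simp: m_def)
  have A: "0 \<le> A" "A < 1" and Z: "0 \<le> Z" "Z < 1" using a z by (auto simp: A_def Z_def)
  have q1: "1 - A \<le> q" using norm_one_minus_cnj_mult[of a z] a z by (simp add: A_def q_def)
  have "norm (cnj a * z) \<le> 1"
    using mult_strict_mono[of "norm a" 1 "norm z" 1] a z by (simp add: norm_mult)
  then have q2: "q \<le> 2"
    using norm_triangle_ineq4[of 1 "cnj a * z"] by (simp add: q_def)
  have q0: "q > 0" using q1 A by linarith
  have eq: "(1 - m\<^sup>2) * q\<^sup>2 = (1 - A\<^sup>2) * (1 - Z\<^sup>2)"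
    using one_minus_norm_Moebius[OF a z] by (simp add: m_def A_def Z_def q_def)
  have e: "1 - m\<^sup>2 = (1 - m) * (1 + m)" "1 - A\<^sup>2 = (1 - A) * (1 + A)" "1 - Z\<^sup>2 = (1 - Z) * (1 + Z)"
    by (simp_all add: algebra_simps power2_eq_square)
  have "(1 - m) * (1 - A)\<^sup>2 \<le> (1 - m\<^sup>2) * q\<^sup>2"
    using m A q1 unfolding e by (intro mult_mono power_mono) (auto simp: mult_left_le)
  also have "\<dots> = (1 - A) * ((1 + A) * ((1 - Z) * (1 + Z)))"
    unfolding eq unfolding e by (simp add: algebra_simps)
  also have "\<dots> \<le> (1 - A) * (2 * ((1 - Z) * 2))"
    using A Z by (intro mult_left_mono mult_mono) auto
  finally have "(1 - A) * ((1 - m) * (1 - A)) \<le> (1 - A) * (4 * (1 - Z))"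
    by (simp add: power2_eq_square algebra_simps)
  then have "(1 - m) * (1 - A) \<le> 4 * (1 - Z)" using A by simp
  then show "1 - norm (Moebius_function 0 a z) \<le> 4 / (1 - norm a) * (1 - norm z)"
    using A by (simp add: m_def A_def Z_def field_simps)
  have "(1 - A) * (1 - Z) \<le> (1 - A\<^sup>2) * (1 - Z\<^sup>2)"
    using A Z unfolding e by (intro mult_mono) (auto simp: mult_left_le)
  also have "\<dots> = ((1 - m) * (1 + m)) * q\<^sup>2" unfolding eq[symmetric] unfolding e by simp
  also have "\<dots> \<le> ((1 - m) * 2) * 2\<^sup>2"
    using m q0 q2 by (intro mult_mono power_mono) auto
  finally show "(1 - norm a) / 8 * (1 - norm z) \<le> 1 - norm (Moebius_function 0 a z)"
    by (simp add: m_def A_def Z_def)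
qed

text \<open>The difference quotient is \<open>1 - a * cnj a\<close> over two denominators, each of
  modulus at least \<open>1 - norm a\<close>.\<close>

lemma Moebius_lipschitz:
  assumes a: "norm a < 1" and z: "norm z < 1" and w: "norm w < 1"
  shows "norm (Moebius_function 0 a z - Moebius_function 0 a w) \<le> 2 / (1 - norm a)\<^sup>2 * norm (z - w)"
proof -
  define d where "d = 1 - norm a"
  have d: "d > 0" using a by (simp add: d_def)
  have dz: "d \<le> norm (1 - cnj a * z)" and dw: "d \<le> norm (1 - cnj a * w)"
    using norm_one_minus_cnj_mult[of a] a z w by (auto simp: d_def)
  have nz: "1 - cnj a * z \<noteq> 0" "1 - cnj a * w \<noteq> 0" using dz dw d by auto
  have "Moebius_function 0 a z - Moebius_function 0 a w
      = (z - w) * (1 - a * cnj a) / ((1 - cnj a * z) * (1 - cnj a * w))"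
    using nz by (simp add: Moebius_function_simple divide_simps) (simp add: algebra_simps)
  then have "norm (Moebius_function 0 a z - Moebius_function 0 a w)
      = norm (z - w) * norm (1 - a * cnj a) / (norm (1 - cnj a * z) * norm (1 - cnj a * w))"
    by (simp add: norm_mult norm_divide)
  also have "\<dots> \<le> norm (z - w) * 2 / (d * d)"
  proof (intro frac_le mult_mono mult_left_mono)
    have "norm (a * cnj a) \<le> 1"
      using mult_strict_mono[of "norm a" 1 "norm a" 1] a by (simp add: norm_mult)
    then show "norm (1 - a * cnj a) \<le> 2"
      using norm_triangle_ineq4[of 1 "a * cnj a"] by simp
  qed (use d dz dw in auto)
  finally show ?thesis by (simp add: d_def power2_eq_square mult.commute)
qed

lemma Blaschke_list_norm:
  assumes "set as \<subseteq> unit_disk" "norm z < 1"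
  shows "norm (\<Prod>a\<leftarrow>as. Moebius_function 0 a z) \<le> 1"
  using assms
proof (induction as)
  case (Cons a as)
  then show ?case
    using Moebius_function_norm_lt_1[of a z 0]
    by (auto simp: norm_mult intro!: mult_le_one)
qed auto

text \<open>Product rule for differences: all factors are bounded by 1, so the Lipschitz constants
  add up.\<close>

lemma Blaschke_list_lipschitz:
  assumes "set as \<subseteq> unit_disk"
  shows "\<exists>L\<ge>0. \<forall>z w. norm z < 1 \<longrightarrow> norm w < 1 \<longrightarrow>
    norm ((\<Prod>a\<leftarrow>as. Moebius_function 0 a z) - (\<Prod>a\<leftarrow>as. Moebius_function 0 a w)) \<le> L * norm (z - w)"
  using assms
proof (induction as)
  case Nil
  show ?case by (intro exI[of _ 0]) auto
next
  case (Cons a as)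
  define B where "B = (\<lambda>z. \<Prod>a\<leftarrow>as. Moebius_function 0 a z)"
  from Cons obtain L where L: "L \<ge> 0" "\<And>z w. norm z < 1 \<Longrightarrow> norm w < 1 \<Longrightarrow> norm (B z - B w) \<le> L * norm (z - w)"
    unfolding B_def by auto
  have a: "norm a < 1" using Cons by auto
  define M where "M = 2 / (1 - norm a)\<^sup>2"
  have M: "M \<ge> 0" by (simp add: M_def)
  show ?case
  proof (intro exI[of _ "M + L"] conjI allI impI)
    fix z w :: complex assume z: "norm z < 1" and w: "norm w < 1"
    have "norm (Moebius_function 0 a z * B z - Moebius_function 0 a w * B w)
      = norm ((Moebius_function 0 a z - Moebius_function 0 a w) * B z + Moebius_function 0 a w * (B z - B w))"
      by (simp add: algebra_simps)
    also have "\<dots> \<le> norm ((Moebius_function 0 a z - Moebius_function 0 a w) * B z) + norm (Moebius_function 0 a w * (B z - B w))"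
      by (rule norm_triangle_ineq)
    also have "\<dots> \<le> M * norm (z - w) * 1 + 1 * (L * norm (z - w))"
      unfolding norm_mult
    proof (intro add_mono mult_mono)
      show "norm (B z) \<le> 1" unfolding B_def using Blaschke_list_norm Cons.prems z by auto
    qed (use Moebius_lipschitz[OF a z w] Moebius_function_norm_lt_1[OF a w, of 0] L z w M in \<open>auto simp: M_def\<close>)
    finally show "norm ((\<Prod>a\<leftarrow>a # as. Moebius_function 0 a z) - (\<Prod>a\<leftarrow>a # as. Moebius_function 0 a w)) \<le> (M + L) * norm (z - w)"
      by (simp add: B_def algebra_simps)
  qed (use L M in auto)
qed

text \<open>For \<open>x\<close> and \<open>y\<close> in the unit interval
  \<open>1 - x * y \<le> (1 - x) + (1 - y)\<close>, so the constants of the factors add up.\<close>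

lemma Blaschke_list_upper:
  assumes "set as \<subseteq> unit_disk"
  shows "\<exists>C\<ge>0. \<forall>z. norm z < 1 \<longrightarrow> 1 - norm (\<Prod>a\<leftarrow>as. Moebius_function 0 a z) \<le> C * (1 - norm z)"
  using assms
proof (induction as)
  case Nil
  show ?case by (intro exI[of _ 0]) auto
next
  case (Cons a as)
  define B where "B = (\<lambda>z. \<Prod>a\<leftarrow>as. Moebius_function 0 a z)"
  from Cons obtain C where C: "C \<ge> 0" "\<And>z. norm z < 1 \<Longrightarrow> 1 - norm (B z) \<le> C * (1 - norm z)"
    unfolding B_def by auto
  have a: "norm a < 1" using Cons by auto
  show ?case
  proof (intro exI[of _ "4 / (1 - norm a) + C"] conjI allI impI)
    fix z :: complex assume z: "norm z < 1"
    have B: "norm (B z) \<le> 1" unfolding B_def using Blaschke_list_norm Cons.prems z by auto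
    define m where "m = norm (Moebius_function 0 a z)"
    have "m \<le> 1" using Moebius_function_norm_lt_1[OF a z, of 0] by (simp add: m_def)
    then have "0 \<le> (1 - m) * (1 - norm (B z))" using B by simp
    then have "1 - m * norm (B z) \<le> (1 - m) + (1 - norm (B z))"
      by (simp add: algebra_simps)
    also have "\<dots> \<le> 4 / (1 - norm a) * (1 - norm z) + C * (1 - norm z)"
      using C(2)[OF z] Moebius_boundary_distance(1)[OF a z] by (simp add: m_def)
    finally show "1 - norm (\<Prod>a\<leftarrow>a # as. Moebius_function 0 a z) \<le> (4 / (1 - norm a) + C) * (1 - norm z)"
      by (simp add: norm_mult m_def B_def algebra_simps)
  qed (use C a in auto)
qed

text \<open>The lower bound for \<open>1 - norm (\<phi> z)\<close> comes from a single factor, which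
  exists because the list is nonempty; the others only decrease the modulus. The upper bound
  involves all factors.\<close>

lemma finite_Blaschke_product_bounds:
  assumes "finite_Blaschke_product \<phi>"
  obtains L c C where "0 \<le> L" "0 < c" "0 \<le> C"
    "\<And>z. norm z < 1 \<Longrightarrow> norm (\<phi> z) < 1"
    "\<And>z w. norm z < 1 \<Longrightarrow> norm w < 1 \<Longrightarrow> norm (\<phi> z - \<phi> w) \<le> L * norm (z - w)"
    "\<And>z. norm z < 1 \<Longrightarrow> c * (1 - norm z) \<le> 1 - norm (\<phi> z)"
    "\<And>z. norm z < 1 \<Longrightarrow> 1 - norm (\<phi> z) \<le> C * (1 - norm z)"
proof -
  from assms obtain k as where k: "norm k = 1" and as: "as \<noteq> []" "set as \<subseteq> unit_disk"
    and \<phi>: "\<And>z. norm z < 1 \<Longrightarrow> \<phi> z = k * (\<Prod>a\<leftarrow>as. Moebius_function 0 a z)"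
    unfolding finite_Blaschke_product_def by auto
  obtain L where L: "L \<ge> 0" "\<And>z w. norm z < 1 \<Longrightarrow> norm w < 1 \<Longrightarrow>
    norm ((\<Prod>a\<leftarrow>as. Moebius_function 0 a z) - (\<Prod>a\<leftarrow>as. Moebius_function 0 a w)) \<le> L * norm (z - w)"
    using Blaschke_list_lipschitz[OF as(2)] by auto
  obtain C where C: "C \<ge> 0" "\<And>z. norm z < 1 \<Longrightarrow> 1 - norm (\<Prod>a\<leftarrow>as. Moebius_function 0 a z) \<le> C * (1 - norm z)"
    using Blaschke_list_upper[OF as(2)] by auto
  obtain b bs where bs: "as = b # bs" using as(1) by (cases as) auto
  have b: "norm b < 1" using as bs by auto
  define c where "c = (1 - norm b) / 8"
  have c: "c > 0" using b by (simp add: c_def)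
  have lower: "c * (1 - norm z) \<le> 1 - norm (\<phi> z)" if z: "norm z < 1" for z
  proof -
    have "norm (\<phi> z) = norm (Moebius_function 0 b z) * norm (\<Prod>a\<leftarrow>bs. Moebius_function 0 a z)"
      using k by (simp add: \<phi>[OF z] norm_mult bs)
    also have "\<dots> \<le> norm (Moebius_function 0 b z)"
      using Blaschke_list_norm[of bs z] as bs z by (intro mult_right_le_one_le) auto
    finally show ?thesis using Moebius_boundary_distance(2)[OF b z] by (simp add: c_def)
  qed
  show thesis
  proof (rule that[OF L(1) c C(1)])
    show "norm (\<phi> z) < 1" if z: "norm z < 1" for z
    proof -
      have "0 < c * (1 - norm z)" using c z by simp
      then show ?thesis using lower[OF z] by linarith
    qed
    show "norm (\<phi> z - \<phi> w) \<le> L * norm (z - w)" if "norm z < 1" "norm w < 1" for z w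
      using L(2)[OF that] k by (simp add: \<phi> that norm_mult flip: right_diff_distrib)
    show "1 - norm (\<phi> z) \<le> C * (1 - norm z)" if "norm z < 1" for z
      using C(2)[OF that] k by (simp add: \<phi> that norm_mult)
  qed (use lower in auto)
qed

section \<open>Test functions and the bound for the symbol\<close>

lemma nn_integral_disk_area:
  assumes g [measurable]: "g \<in> borel_measurable borel"
  shows "(\<integral>\<^sup>+ z. g z \<partial>disk_area) = ennreal (1 / pi) * (\<integral>\<^sup>+ z. g z * indicator unit_disk z \<partial>lborel)"
proof -
  have g': "g \<in> borel_measurable lebesgue"
    using g by (simp add: measurable_completion)
  have "(\<integral>\<^sup>+ z. g z \<partial>disk_area) = ennreal (1 / pi) * (\<integral>\<^sup>+ z. g z \<partial>lebesgue_on unit_disk)"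
    unfolding disk_area_def by (intro nn_integral_scale_measure measurable_restrict_space1 g')
  also have "(\<integral>\<^sup>+ z. g z \<partial>lebesgue_on unit_disk) = (\<integral>\<^sup>+ z. g z * indicator unit_disk z \<partial>lebesgue)"
    by (rule nn_integral_restrict_space) simp
  finally show ?thesis by (simp add: nn_integral_completion)
qed

lemma space_disk_area: "space disk_area = unit_disk"
  by (simp add: disk_area_def space_scale_measure space_restrict_space)

text \<open>The origin is left out because \<open>regular_weights\<close> does not control \<open>\<omega> 0\<close>.\<close>

lemma bergman_integral_le:
  assumes g [measurable]: "g \<in> borel_measurable borel"
    and le: "\<And>z. z \<noteq> 0 \<Longrightarrow> norm z < 1 \<Longrightarrow> ennreal (norm (f z) powr p * \<omega> z) \<le> g z"
  shows "bergman_integral p \<omega> f \<le> ennreal (1 / pi) * (\<integral>\<^sup>+ z. g z * indicator unit_disk z \<partial>lborel)"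
proof -
  \<comment> \<open>The value \<open>top\<close> at the origin makes the comparison valid at every
    point of the disk, and one point is a null set.\<close>
  have "bergman_integral p \<omega> f \<le> (\<integral>\<^sup>+ z. (if z = 0 then top else g z) \<partial>disk_area)"
    unfolding bergman_integral_def using le by (intro nn_integral_mono) (auto simp: space_disk_area)
  also have "\<dots> = ennreal (1 / pi) * (\<integral>\<^sup>+ z. (if z = 0 then top else g z) * indicator unit_disk z \<partial>lborel)"
    by (rule nn_integral_disk_area) measurable
  also have "(\<integral>\<^sup>+ z. (if z = 0 then top else g z) * indicator unit_disk z \<partial>lborel)
     = (\<integral>\<^sup>+ z. g z * indicator unit_disk z \<partial>lborel)"
    by (intro nn_integral_cong_AE AE_I'[OF finite_imp_null_set_lborel[of "{0}"]]) auto
  finally show ?thesis .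
qed

text \<open>The minorant is set to 0 at the origin, which preserves its integral and makes the
  comparison hold everywhere.\<close>

lemma bergman_integral_ge:
  assumes g [measurable]: "g \<in> borel_measurable borel"
    and le: "\<And>z. z \<noteq> 0 \<Longrightarrow> norm z < 1 \<Longrightarrow> g z \<le> ennreal (norm (f z) powr p * \<omega> z)"
  shows "ennreal (1 / pi) * (\<integral>\<^sup>+ z. g z * indicator unit_disk z \<partial>lborel) \<le> bergman_integral p \<omega> f"
proof -
  have "(\<integral>\<^sup>+ z. g z * indicator unit_disk z \<partial>lborel)
     = (\<integral>\<^sup>+ z. (if z = 0 then 0 else g z) * indicator unit_disk z \<partial>lborel)"
    by (intro nn_integral_cong_AE AE_I'[OF finite_imp_null_set_lborel[of "{0}"]]) auto
  then have "ennreal (1 / pi) * (\<integral>\<^sup>+ z. g z * indicator unit_disk z \<partial>lborel)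
    = (\<integral>\<^sup>+ z. (if z = 0 then 0 else g z) \<partial>disk_area)"
    by (subst nn_integral_disk_area) auto
  also have "\<dots> \<le> bergman_integral p \<omega> f"
    unfolding bergman_integral_def using le by (intro nn_integral_mono) (auto simp: space_disk_area)
  finally show ?thesis .
qed

section \<open>Powers of the kernel as test functions\<close>

text \<open>A power of the Szego kernel at \<open>a\<close>. With a natural exponent no branch of a
  power has to be chosen.\<close>

definition kernel_power :: "nat \<Rightarrow> complex \<Rightarrow> complex \<Rightarrow> complex" where
  "kernel_power m a z = inverse (1 - cnj a * z) ^ m"

lemma norm_kernel_power:
  assumes "norm a < 1" "norm z \<le> 1"
  shows "norm (kernel_power m a z) powr p = (1 / norm (1 - cnj a * z)) powr (m * p)"
proof -
  have "0 < norm (1 - cnj a * z)"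
    using norm_one_minus_cnj_mult[OF assms] assms by linarith
  then show ?thesis
    by (simp add: kernel_power_def norm_power norm_inverse norm_divide powr_powr inverse_eq_divide flip: powr_realpow)
qed

lemma kernel_power_holomorphic:
  assumes "norm a < 1"
  shows "kernel_power m a holomorphic_on unit_disk"
proof -
  have "1 - cnj a * z \<noteq> 0" if "z \<in> unit_disk" for z
    using norm_one_minus_cnj_mult[of a z] that assms by auto
  then show ?thesis
    unfolding kernel_power_def by (intro holomorphic_intros) auto
qed

text \<open>With \<open>\<xi> = a / norm a\<close>, \<open>norm (\<xi> - z)\<close> exceeds
  \<open>norm (1 - cnj a * z)\<close> by at most \<open>norm (\<xi> - a) = 1 - norm a\<close>, which
  is itself at most \<open>norm (1 - cnj a * z)\<close>. Small distance in the kernel thus means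
  membership in a small box at \<xi>.\<close>

lemma kernel_boundary_point:
  assumes a: "norm a < 1"
  obtains \<xi> where "norm \<xi> = 1" "\<And>z. norm z \<le> 1 \<Longrightarrow> norm (\<xi> - z) \<le> 2 * norm (1 - cnj a * z)"
proof -
  define \<xi> where "\<xi> = (if a = 0 then 1 else a / of_real (norm a))"
  have \<xi>: "norm \<xi> = 1" "a = of_real (norm a) * \<xi>" by (auto simp: \<xi>_def norm_divide)
  show thesis
  proof (rule that[OF \<xi>(1)])
    fix z :: complex assume z: "norm z \<le> 1"
    have 1: "cnj \<xi> * \<xi> = 1" using \<xi>(1) by (simp add: complex_norm_square[symmetric] mult.commute)
    have "norm (\<xi> - z) = norm (cnj \<xi> * (\<xi> - z))" using \<xi>(1) by (simp add: norm_mult)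
    also have "cnj \<xi> * (\<xi> - z) = (1 - cnj a * z) - (cnj \<xi> - cnj a) * z"
      by (simp add: right_diff_distrib left_diff_distrib 1)
    also have "norm \<dots> \<le> norm (1 - cnj a * z) + norm ((cnj \<xi> - cnj a) * z)"
      by (rule norm_triangle_ineq4)
    also have "norm ((cnj \<xi> - cnj a) * z) \<le> norm (cnj \<xi> - cnj a)"
      using z by (simp add: norm_mult mult_left_le)
    also have "norm (cnj \<xi> - cnj a) = 1 - norm a"
    proof -
      have "\<xi> - a = of_real (1 - norm a) * \<xi>" by (subst \<xi>(2)) (simp add: left_diff_distrib)
      then have "norm (\<xi> - a) = 1 - norm a" using a \<xi>(1) by (simp add: norm_mult del: of_real_diff)
      then show ?thesis by (metis complex_cnj_diff complex_mod_cnj)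
    qed
    also have "1 - norm a \<le> norm (1 - cnj a * z)" by (rule norm_one_minus_cnj_mult[OF a z])
    finally show "norm (\<xi> - z) \<le> 2 * norm (1 - cnj a * z)" by simp
  qed
qed

context regular_weight
begin

lemma weight_le_W_norm: "z \<noteq> 0 \<Longrightarrow> norm z < 1 \<Longrightarrow> \<omega> z \<le> C * W (norm z)"
  using weight_le_W[of "norm z"] weight_radial[of z] by simp

lemma W_le_weight_norm: "z \<noteq> 0 \<Longrightarrow> norm z < 1 \<Longrightarrow> W (norm z) \<le> C * \<omega> z"
  using W_le_weight[of "norm z"] weight_radial[of z] by simp

text \<open>The disk is covered by the boxes of size \<open>2 ^ k * (1 - norm a)\<close> at the boundary point
  nearest to \<open>a\<close>. The exponent makes the decay of the kernel beat the doubling constant.\<close>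

lemma bergman_integral_kernel_power:
  assumes p: "1 \<le> p" and m: "4 * A \<le> 2 ^ m" and a: "norm a < 1"
  defines "\<delta> \<equiv> 1 - norm a"
  shows "bergman_integral p \<omega> (kernel_power m a)
    \<le> ennreal (12 * C\<^sup>2 * (4 / \<delta>) powr (m * p) * \<delta> * T (1 - \<delta>))"
proof -
  define q where "q = m * p"
  have q: "real m \<le> q" using p by (simp add: q_def mult_left_le mult_le_cancel_left1)
  have \<delta>: "0 < \<delta>" "\<delta> \<le> 1" using a by (auto simp: \<delta>_def)
  obtain \<xi> where \<xi>: "norm \<xi> = 1" "\<And>z. norm z \<le> 1 \<Longrightarrow> norm (\<xi> - z) \<le> 2 * norm (1 - cnj a * z)"
    using kernel_boundary_point[OF a] by blast
  define S where "S = (\<lambda>k. unit_disk \<inter> ball \<xi> (2 ^ k * \<delta>))"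
  have S [measurable]: "S k \<in> sets borel" for k by (simp add: S_def)
  \<comment> \<open>If \<open>k\<close> is the least index of a box containing \<open>z\<close>,
    then \<open>norm (1 - cnj a * z)\<close> is at least \<open>2 ^ k * \<delta> / 4\<close>; this
    bounds the kernel there, and \<open>C\<close> compares the weight with \<open>W\<close>.\<close>
  define c where "c = (\<lambda>k. C * (4 / (2 ^ k * \<delta>)) powr q)"
  have c0: "0 \<le> c k" for k using C1 by (simp add: c_def)
  \<comment> \<open>The boxes are nested and the terms overlap; for an upper bound it is enough that
    one term majorises the integrand at each point.\<close>
  define g where "g = (\<lambda>z. \<Sum>k. ennreal (c k) * (ennreal (W (norm z)) * indicator (S k) z))"
  have [measurable]: "g \<in> borel_measurable borel" unfolding g_def by measurable
  define B where "B = 6 * pi * C\<^sup>2 * (4 / \<delta>) powr q * \<delta> * T (1 - \<delta>)"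
  have B: "0 \<le> B" unfolding B_def using \<delta> tail_nonneg[of "1 - \<delta>"] by simp
  have box: "(\<integral>\<^sup>+ z. ennreal (c k) * (ennreal (W (norm z)) * indicator (S k) z) \<partial>lborel) \<le> ennreal (B * (1 / 2) ^ k)" for k
  proof -
    have "(\<integral>\<^sup>+ z. ennreal (c k) * (ennreal (W (norm z)) * indicator (S k) z) \<partial>lborel)
      = ennreal (c k) * (\<integral>\<^sup>+ z. ennreal (W (norm z)) * indicator (S k) z \<partial>lborel)"
      by (rule nn_integral_cmult) measurable
    also have "\<dots> \<le> ennreal (c k) * (ennreal (3 * (2 ^ k * \<delta>)) * H (2 ^ k * \<delta>))"
      unfolding S_def using \<delta> by (intro mult_left_mono Carleson_box \<xi>) auto
    also have "\<dots> \<le> ennreal (c k) * (ennreal (3 * (2 ^ k * \<delta>)) * ennreal (2 * pi * C * (A ^ k * T (1 - \<delta>))))"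
      using \<delta> C1 by (intro mult_left_mono order_trans[OF H_le] ennreal_leI tail_doubling_iterate) auto
    also have "\<dots> = ennreal (c k * (3 * (2 ^ k * \<delta>) * (2 * pi * C * (A ^ k * T (1 - \<delta>)))))"
      using c0 \<delta> C1 A(1) tail_nonneg[of "1 - \<delta>"] by (simp add: ennreal_mult[symmetric])
    also have "\<dots> \<le> ennreal (B * (1 / 2) ^ k)"
    proof (rule ennreal_leI)
      have "(4 / (2 ^ k * \<delta>)) powr q = (4 / \<delta>) powr q * (1 / 2 ^ k) powr q"
        using \<delta> by (simp add: mult.commute flip: powr_mult)
      \<comment> \<open>The decay \<open>(4 * A) ^ k\<close> absorbs \<open>2 ^ k\<close> from the
        width of the box and \<open>A ^ k\<close> from doubling, and leaves the ratio 1/2.\<close>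
      also have "\<dots> \<le> (4 / \<delta>) powr q * (1 / (4 * A)) ^ k"
      proof (rule mult_left_mono)
        have "(1 / 2 ^ k) powr q \<le> (1 / 2 ^ k) powr (real m)"
          using q by (intro powr_mono') auto
        also have "\<dots> = (1 / 2 ^ m) ^ k"
          by (simp add: powr_realpow power_divide mult.commute flip: power_mult)
        also have "\<dots> \<le> (1 / (4 * A)) ^ k"
          using m A(1) by (intro power_mono divide_left_mono) auto
        finally show "(1 / 2 ^ k) powr q \<le> (1 / (4 * A)) ^ k" .
      qed auto
      finally have "c k * (3 * (2 ^ k * \<delta>) * (2 * pi * C * (A ^ k * T (1 - \<delta>))))
          \<le> C * ((4 / \<delta>) powr q * (1 / (4 * A)) ^ k) * (3 * (2 ^ k * \<delta>) * (2 * pi * C * (A ^ k * T (1 - \<delta>))))"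
        unfolding c_def using C1 \<delta> A(1) tail_nonneg[of "1 - \<delta>"]
        by (intro mult_right_mono mult_left_mono) auto
      also have "\<dots> = B * ((1 / (4 * A)) ^ k * 2 ^ k * A ^ k)"
        by (simp add: B_def power2_eq_square)
      also have "(1 / (4 * A)) ^ k * 2 ^ k * A ^ k = (1 / 2) ^ k"
        using A(1) by (simp flip: power_mult_distrib)
      finally show "c k * (3 * (2 ^ k * \<delta>) * (2 * pi * C * (A ^ k * T (1 - \<delta>)))) \<le> B * (1 / 2) ^ k" .
    qed
    finally show ?thesis .
  qed
  have "bergman_integral p \<omega> (kernel_power m a) \<le> ennreal (1 / pi) * (\<integral>\<^sup>+ z. g z * indicator unit_disk z \<partial>lborel)"
  proof (rule bergman_integral_le)
    fix z :: complex assume z: "z \<noteq> 0" "norm z < 1"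
    define D where "D = norm (1 - cnj a * z)"
    have D: "\<delta> \<le> D" "norm (\<xi> - z) \<le> 2 * D"
      using norm_one_minus_cnj_mult[OF a, of z] \<xi>(2)[of z] z by (auto simp: D_def \<delta>_def)
    obtain n where "norm (\<xi> - z) / \<delta> < 2 ^ n" using real_arch_pow[of 2] by auto
    then have ex: "norm (\<xi> - z) < 2 ^ n * \<delta>" using \<delta> by (simp add: pos_divide_less_eq)
    \<comment> \<open>Minimality supplies the lower bound for \<open>D\<close>: the preceding box
      misses \<open>z\<close>, so \<open>2 ^ (k - 1) * \<delta> \<le> 2 * D\<close>; for
      \<open>k = 0\<close> the bound \<open>\<delta> \<le> D\<close> takes over.\<close>
    define k where "k = (LEAST n. norm (\<xi> - z) < 2 ^ n * \<delta>)"
    have k: "norm (\<xi> - z) < 2 ^ k * \<delta>" unfolding k_def using ex by (rule LeastI)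
    have k': "2 ^ k * \<delta> \<le> 4 * D"
    proof (cases k)
      case 0
      then show ?thesis using D \<delta> by simp
    next
      case (Suc j)
      then have "\<not> norm (\<xi> - z) < 2 ^ j * \<delta>"
        using not_less_Least[of j "\<lambda>n. norm (\<xi> - z) < 2 ^ n * \<delta>"] by (simp add: k_def)
      then have "2 ^ j * \<delta> \<le> 2 * D" using D(2) by linarith
      then show ?thesis using Suc by (simp add: mult_ac)
    qed
    have "norm (kernel_power m a z) powr p * \<omega> z \<le> (4 / (2 ^ k * \<delta>)) powr q * (C * W (norm z))"
    proof (intro mult_mono)
      have "1 / D \<le> 4 / (2 ^ k * \<delta>)" using k' D(1) \<delta> by (simp add: field_simps)
      then show "norm (kernel_power m a z) powr p \<le> (4 / (2 ^ k * \<delta>)) powr q"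
        using norm_kernel_power[OF a, of z m p] z p D(1) \<delta>
        by (auto simp: D_def[symmetric] q_def intro!: powr_mono2)
    qed (use weight_le_W_norm[OF z] weight_pos[of z] z in auto)
    also have "\<dots> = c k * W (norm z)" by (simp add: c_def)
    finally have "ennreal (norm (kernel_power m a z) powr p * \<omega> z) \<le> ennreal (c k) * (ennreal (W (norm z)) * indicator (S k) z)"
      using k z c0 W_nonneg[of "norm z"] by (simp add: S_def dist_norm ennreal_mult[symmetric] ennreal_leI)
    also have "\<dots> \<le> g z"
      using sum_le_suminf[of "\<lambda>k. ennreal (c k) * (ennreal (W (norm z)) * indicator (S k) z)" "{k}"]
      by (simp add: g_def)
    finally show "ennreal (norm (kernel_power m a z) powr p * \<omega> z) \<le> g z" .
  qed measurable
  also have "(\<integral>\<^sup>+ z. g z * indicator unit_disk z \<partial>lborel) \<le> (\<integral>\<^sup>+ z. g z \<partial>lborel)"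
    by (intro nn_integral_mono) (auto simp: indicator_def)
  also have "(\<integral>\<^sup>+ z. g z \<partial>lborel) = (\<Sum>k. \<integral>\<^sup>+ z. ennreal (c k) * (ennreal (W (norm z)) * indicator (S k) z) \<partial>lborel)"
    unfolding g_def by (rule nn_integral_suminf) measurable
  also have "\<dots> \<le> (\<Sum>k. ennreal (B * (1 / 2) ^ k))"
    by (intro suminf_le box) auto
  also have "\<dots> = ennreal (B * 2)"
    using B sums_mult[OF geometric_sums[of "1/2::real"], of B]
    by (intro suminf_ennreal_eq) auto
  also have "ennreal (1 / pi) * ennreal (B * 2) = ennreal (12 * C\<^sup>2 * (4 / \<delta>) powr (m * p) * \<delta> * T (1 - \<delta>))"
  proof -
    have "1 / pi * (B * 2) = 12 * C\<^sup>2 * (4 / \<delta>) powr (m * p) * \<delta> * T (1 - \<delta>)"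
      by (simp add: B_def q_def)
    moreover have "ennreal (1 / pi) * ennreal (B * 2) = ennreal (1 / pi * (B * 2))"
      using B by (intro ennreal_mult[symmetric]) auto
    ultimately show ?thesis by (simp only:)
  qed
  finally show ?thesis by (simp add: mult_left_mono)
qed

end

section \<open>Comparison of the two bounds\<close>

text \<open>\<open>bergman_norm\<close> passes through \<open>enn2real\<close>, which sends infinity
  to 0. Since \<open>f\<close> and \<open>F f\<close> both lie in the space, both integrals are
  finite and the norm estimate can be read in \<open>ennreal\<close>. The absolute value of
  \<open>K\<close> covers a constant of unknown sign.\<close>

lemma bounded_on_bergman_space_integral:
  assumes bdd: "bounded_on_bergman_space p \<omega> F" and p: "0 < p"
  obtains M where "0 \<le> M" "\<And>f. f \<in> bergman_space p \<omega> \<Longrightarrow>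
    bergman_integral p \<omega> (F f) \<le> ennreal M * bergman_integral p \<omega> f"
proof -
  obtain K where maps: "\<And>f. f \<in> bergman_space p \<omega> \<Longrightarrow> F f \<in> bergman_space p \<omega>"
    and K: "\<And>f. f \<in> bergman_space p \<omega> \<Longrightarrow> bergman_norm p \<omega> (F f) \<le> K * bergman_norm p \<omega> f"
    using bdd unfolding bounded_on_bergman_space_def by blast
  have root: "bergman_norm p \<omega> f powr p = enn2real (bergman_integral p \<omega> f)" for f
    using p by (simp add: bergman_norm_def powr_powr)
  show thesis
  proof (rule that[of "\<bar>K\<bar> powr p"])
    fix f assume f: "f \<in> bergman_space p \<omega>"
    have nn: "0 \<le> bergman_norm p \<omega> g" for g by (simp add: bergman_norm_def)
    have "bergman_norm p \<omega> (F f) \<le> \<bar>K\<bar> * bergman_norm p \<omega> f"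
      using K[OF f] mult_right_mono[OF abs_ge_self nn, of K f] by linarith
    then have "bergman_norm p \<omega> (F f) powr p \<le> (\<bar>K\<bar> * bergman_norm p \<omega> f) powr p"
      using nn p by (intro powr_mono2) auto
    then have "enn2real (bergman_integral p \<omega> (F f)) \<le> \<bar>K\<bar> powr p * enn2real (bergman_integral p \<omega> f)"
      using nn by (simp add: powr_mult root)
    then have "ennreal (enn2real (bergman_integral p \<omega> (F f))) \<le> ennreal (\<bar>K\<bar> powr p) * ennreal (enn2real (bergman_integral p \<omega> f))"
      by (simp add: ennreal_leI flip: ennreal_mult)
    moreover have "bergman_integral p \<omega> g < top" if "g \<in> bergman_space p \<omega>" for g
      using that by (simp add: bergman_space_def)
    ultimately show "bergman_integral p \<omega> (F f) \<le> ennreal (\<bar>K\<bar> powr p) * bergman_integral p \<omega> f"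
      using f maps[OF f] by simp
  qed simp
qed

context regular_weight
begin

text \<open>With \<open>d = 1 - norm z0\<close>, the disk stays inside
  \<open>norm z \<le> 1 - d / 2\<close>, so one doubling step bounds the tail from below; the
  denominator \<open>1 - norm z\<close> is at most \<open>3 / 2 * d\<close>.\<close>

lemma W_lower_bound_near:
  fixes z z0 :: complex
  assumes z0: "norm z0 < 1" and z: "z \<in> ball z0 ((1 - norm z0) / 2)"
  shows "norm z < 1" "T (norm z0) / (A * (3 / 2 * (1 - norm z0))) \<le> W (norm z)"
proof -
  define d where "d = 1 - norm z0"
  have d: "0 < d" "d \<le> 1" using z0 by (auto simp: d_def)
  have dz: "norm (z - z0) < d / 2" using z by (simp add: dist_norm norm_minus_commute d_def)
  have n0: "norm z0 = 1 - d" by (simp add: d_def)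
  have up: "norm z \<le> 1 - d / 2"
    using norm_triangle_ineq2[of z z0] dz n0 by argo
  have low: "1 - norm z \<le> 3 / 2 * d"
    using norm_triangle_ineq2[of z0 z] dz n0 norm_minus_commute[of z z0] by argo
  show z1: "norm z < 1" using up d by linarith
  have "T (1 - d) \<le> A * T (1 - d / 2)" by (rule A(2)[OF d])
  also have "\<dots> \<le> A * T (norm z)" using A(1) up by (intro mult_left_mono tail_antimono) auto
  finally have "T (1 - d) / A \<le> T (norm z)" using A(1) by (simp add: field_simps)
  moreover have "0 \<le> T (1 - d) / A" using A(1) d tail_nonneg[of "1 - d"] by simp
  ultimately have "T (1 - d) / A / (3 / 2 * d) \<le> T (norm z) / (1 - norm z)"
    using z1 low by (intro frac_le) auto
  then show "T (norm z0) / (A * (3 / 2 * (1 - norm z0))) \<le> W (norm z)"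
    by (simp add: W_def d_def)
qed

text \<open>The sub-mean value property for \<open>u\<close>, with the weight replaced by its lower
  bound on the disk. The normalised area \<open>d\<^sup>2 / 4\<close> against the
  \<open>3 / 2 * d\<close> in that bound gives \<open>d / 6\<close>.\<close>

lemma bergman_integral_local_lower_bound:
  assumes u: "u holomorphic_on unit_disk" and p: "1 \<le> p" and z0: "norm z0 < 1"
  defines "d \<equiv> 1 - norm z0"
  assumes k: "0 \<le> k" "\<And>z. z \<in> ball z0 (d / 2) \<Longrightarrow> k * norm (u z) powr p \<le> norm (f z) powr p"
  shows "ennreal (k * norm (u z0) powr p * d * T (1 - d) / (6 * A * C)) \<le> bergman_integral p \<omega> f"
proof -
  have d: "0 < d" "d \<le> 1" using z0 by (auto simp: d_def)
  have sub: "ball z0 (d / 2) \<subseteq> unit_disk"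
    using W_lower_bound_near(1)[OF z0] by (auto simp: d_def)
  have uh: "u holomorphic_on ball z0 (d / 2)" using u sub by (rule holomorphic_on_subset)
  define v where "v = (\<lambda>z. indicator (ball z0 (d / 2)) z *\<^sub>R u z)"
  have [measurable]: "v \<in> borel_measurable borel"
    unfolding v_def using holomorphic_on_imp_continuous_on[OF uh]
    by (intro borel_measurable_continuous_on_indicator) auto
  \<comment> \<open>A lower bound for the weight on the punctured small disk: the bound for
    \<open>W\<close> there, divided by the comparison constant \<open>C\<close>.\<close>
  define w where "w = T (1 - d) / (A * (3 / 2 * d) * C)"
  have w: "0 \<le> w" unfolding w_def using A(1) C1 d tail_nonneg[of "1 - d"] by simp
  define g where "g = (\<lambda>z. ennreal (k * w) * ennreal (norm (v z) powr p))"
  have [measurable]: "g \<in> borel_measurable borel" unfolding g_def by measurable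
  have "ennreal (1 / pi) * (\<integral>\<^sup>+ z. g z * indicator unit_disk z \<partial>lborel) \<le> bergman_integral p \<omega> f"
  proof (rule bergman_integral_ge)
    fix z :: complex assume z: "z \<noteq> 0" "norm z < 1"
    show "g z \<le> ennreal (norm (f z) powr p * \<omega> z)"
    proof (cases "z \<in> ball z0 (d / 2)")
      case True
      have "w * C \<le> W (norm z)"
        using W_lower_bound_near(2)[OF z0, of z] True C1 by (simp add: w_def d_def)
      also have "\<dots> \<le> C * \<omega> z" by (rule W_le_weight_norm[OF z])
      finally have "w \<le> \<omega> z" using C1 by (simp add: mult.commute)
      then have "(k * norm (u z) powr p) * w \<le> norm (f z) powr p * \<omega> z"
        using k(1) k(2)[OF True] w by (intro mult_mono) auto
      then show ?thesis using True k(1) w by (simp add: g_def v_def ennreal_leI mult_ac flip: ennreal_mult)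
    next
      case False
      then show ?thesis by (simp add: g_def v_def)
    qed
  qed measurable
  also have "(\<integral>\<^sup>+ z. g z * indicator unit_disk z \<partial>lborel)
      = (\<integral>\<^sup>+ z. ennreal (k * w) * (ennreal (norm (u z) powr p) * indicator (ball z0 (d / 2)) z) \<partial>lborel)"
    using sub by (intro nn_integral_cong) (auto simp: g_def v_def indicator_def)
  also have "\<dots> = (\<integral>\<^sup>+ z. ennreal (k * w) * ennreal (norm (v z) powr p) \<partial>lborel)"
    by (intro nn_integral_cong) (auto simp: v_def indicator_def)
  also have "\<dots> = ennreal (k * w) * (\<integral>\<^sup>+ z. ennreal (norm (v z) powr p) \<partial>lborel)"
    by (rule nn_integral_cmult) measurable
  also have "(\<integral>\<^sup>+ z. ennreal (norm (v z) powr p) \<partial>lborel)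
      = (\<integral>\<^sup>+ z. ennreal (norm (u z) powr p) * indicator (ball z0 (d / 2)) z \<partial>lborel)"
    by (intro nn_integral_cong) (auto simp: v_def indicator_def)
  finally have upper: "ennreal (1 / pi) * (ennreal (k * w) *
    (\<integral>\<^sup>+ z. ennreal (norm (u z) powr p) * indicator (ball z0 (d / 2)) z \<partial>lborel)) \<le> bergman_integral p \<omega> f" .
  have "ennreal (1 / pi) * (ennreal (k * w) * (ennreal (norm (u z0) powr p) * emeasure lborel (ball z0 (d / 2))))
    \<le> ennreal (1 / pi) * (ennreal (k * w) *
      (\<integral>\<^sup>+ z. ennreal (norm (u z) powr p) * indicator (ball z0 (d / 2)) z \<partial>lborel))"
    using d by (intro mult_left_mono powr_sub_mean_value[OF uh p]) auto
  also note upper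
  also have "ennreal (1 / pi) * (ennreal (k * w) * (ennreal (norm (u z0) powr p) * emeasure lborel (ball z0 (d / 2))))
    = ennreal (1 / pi * (k * w * (norm (u z0) powr p * (pi * (d / 2)\<^sup>2))))"
    using d k(1) w by (simp add: emeasure_lborel_ball_complex flip: ennreal_mult)
  also have "1 / pi * (k * w * (norm (u z0) powr p * (pi * (d / 2)\<^sup>2))) = k * norm (u z0) powr p * d * T (1 - d) / (6 * A * C)"
    using d A(1) C1 by (simp add: w_def power2_eq_square field_simps)
  finally show ?thesis .
qed

text \<open>Transfers the tail from the radius of \<open>\<phi> z0\<close> to that of
  \<open>z0\<close>. The number of doublings depends on \<open>K\<close> alone, so the constant is
  uniform in \<open>z0\<close>.\<close>

lemma tail_comparable:
  obtains M where "0 \<le> M" "\<And>d \<delta>. 0 < d \<Longrightarrow> d \<le> 1 \<Longrightarrow> 0 < \<delta> \<Longrightarrow> \<delta> \<le> 1 \<Longrightarrow> \<delta> \<le> K * d \<Longrightarrow> T (1 - \<delta>) \<le> M * T (1 - d)"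
proof -
  obtain j where j: "K < 2 ^ j" using real_arch_pow[of 2 K] by auto
  show thesis
  proof (rule that[of "A ^ j"])
    fix d \<delta> :: real assume d: "0 < d" "d \<le> 1" "0 < \<delta>" "\<delta> \<le> 1" "\<delta> \<le> K * d"
    have "K * d \<le> 2 ^ j * d" using j d by (intro mult_right_mono) auto
    with d(5) have "\<delta> \<le> 2 ^ j * d" by (rule order_trans)
    then have "T (1 - \<delta>) \<le> T (max 0 (1 - 2 ^ j * d))" using d by (intro tail_antimono) auto
    also have "\<dots> \<le> A ^ j * T (1 - d)" by (rule tail_doubling_iterate) (use d in auto)
    finally show "T (1 - \<delta>) \<le> A ^ j * T (1 - d)" .
  qed (use A(1) in auto)
qed

lemma symbol_bounded:
  assumes p: "1 \<le> p" and \<phi>: "finite_Blaschke_product \<phi>" and u: "u holomorphic_on unit_disk"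
    and bdd: "bounded_on_bergman_space p \<omega> (weighted_composition u \<phi>)"
  shows "bounded (u ` unit_disk)"
proof -
  obtain M where M: "0 \<le> M" "\<And>f. f \<in> bergman_space p \<omega> \<Longrightarrow>
    bergman_integral p \<omega> (weighted_composition u \<phi> f) \<le> ennreal M * bergman_integral p \<omega> f"
    using bounded_on_bergman_space_integral[OF bdd] p by auto
  obtain L b K where L: "0 \<le> L" and b: "0 < b" and K: "0 \<le> K"
    and \<phi>_disk: "\<And>z. norm z < 1 \<Longrightarrow> norm (\<phi> z) < 1"
    and \<phi>_lip: "\<And>z w. norm z < 1 \<Longrightarrow> norm w < 1 \<Longrightarrow> norm (\<phi> z - \<phi> w) \<le> L * norm (z - w)"
    and \<phi>_lower: "\<And>z. norm z < 1 \<Longrightarrow> b * (1 - norm z) \<le> 1 - norm (\<phi> z)"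
    and \<phi>_upper: "\<And>z. norm z < 1 \<Longrightarrow> 1 - norm (\<phi> z) \<le> K * (1 - norm z)"
    using finite_Blaschke_product_bounds[OF \<phi>] by metis
  obtain Q where Q: "0 \<le> Q" "\<And>d \<delta>. 0 < d \<Longrightarrow> d \<le> 1 \<Longrightarrow> 0 < \<delta> \<Longrightarrow> \<delta> \<le> 1 \<Longrightarrow> \<delta> \<le> K * d \<Longrightarrow> T (1 - \<delta>) \<le> Q * T (1 - d)"
    using tail_comparable by blast
  obtain m where m: "4 * A < 2 ^ m" using real_arch_pow[of 2 "4 * A"] by auto
  define q where "q = m * p"
  \<comment> \<open>For \<open>z\<close> near \<open>z0\<close>,
    \<open>norm (1 - cnj a * \<phi> z)\<close> is at most \<open>1 - (norm a)\<^sup>2\<close>, hence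
    \<open>2 * \<delta>\<close>, plus \<open>L * d\<close>, and
    \<open>d \<le> \<delta> / b\<close>.\<close>
  define G where "G = 2 + L / b"
  have G: "0 < G" using L b by (simp add: G_def add_pos_nonneg)
  \<comment> \<open>The operator constant times the kernel bound with \<open>(4 * G) powr q\<close>,
    \<open>K\<close> and \<open>Q\<close> inserted, times the denominator of the local lower bound;
    none of these depends on \<open>z0\<close>.\<close>
  define X where "X = M * (12 * C\<^sup>2 * (4 * G) powr q * K * Q) * (6 * A * C)"
  have main: "norm (u z0) powr p \<le> X" if z0: "norm z0 < 1" for z0
  proof -
    define d where "d = 1 - norm z0"
    define a where "a = \<phi> z0"
    define \<delta> where "\<delta> = 1 - norm a"
    have d: "0 < d" "d \<le> 1" using z0 by (auto simp: d_def)
    have a: "norm a < 1" using \<phi>_disk[OF z0] by (simp add: a_def)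
    have \<delta>: "0 < \<delta>" "\<delta> \<le> 1" using a by (auto simp: \<delta>_def)
    have \<delta>d: "b * d \<le> \<delta>" "\<delta> \<le> K * d"
      using \<phi>_lower[OF z0] \<phi>_upper[OF z0] by (auto simp: \<delta>_def d_def a_def)
    define k where "k = (1 / (G * \<delta>)) powr q"
    let ?F = "kernel_power m a"
    have near: "k * norm (u z) powr p \<le> norm (weighted_composition u \<phi> ?F z) powr p"
      if z: "z \<in> ball z0 (d / 2)" for z
    proof -
      have z1: "norm z < 1" using W_lower_bound_near(1)[OF z0] z by (simp add: d_def)
      have \<phi>1: "norm (\<phi> z) < 1" by (rule \<phi>_disk[OF z1])
      define D where "D = norm (1 - cnj a * \<phi> z)"
      have D: "0 < D" using norm_one_minus_cnj_mult[OF a, of "\<phi> z"] \<phi>1 a unfolding D_def by linarith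
      have "1 - cnj a * \<phi> z = (1 - cnj a * a) + cnj a * (a - \<phi> z)" by (simp add: algebra_simps)
      then have "D \<le> norm (1 - cnj a * a) + norm (cnj a * (a - \<phi> z))"
        unfolding D_def by (metis norm_triangle_ineq)
      also have "norm (1 - cnj a * a) = 1 - (norm a)\<^sup>2"
      proof -
        have "1 - cnj a * a = of_real (1 - (norm a)\<^sup>2)" by (simp add: complex_norm_square mult.commute flip: of_real_power)
        then show ?thesis using a by (simp add: abs_square_le_1 del: of_real_diff)
      qed
      also have "1 - (norm a)\<^sup>2 = (1 - norm a) * (1 + norm a)" by (simp add: power2_eq_square algebra_simps)
      also have "\<dots> \<le> \<delta> * 2" unfolding \<delta>_def using a by (intro mult_mono) auto
      also have "norm (cnj a * (a - \<phi> z)) \<le> norm (a - \<phi> z)"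
        using a by (simp add: norm_mult mult_left_le_one_le)
      also have "\<dots> \<le> L * norm (z0 - z)" unfolding a_def by (rule \<phi>_lip[OF z0 z1])
      also have "\<dots> \<le> L * d" using z L d by (intro mult_left_mono) (auto simp: dist_norm)
      also have "L * d \<le> L * (\<delta> / b)" using \<delta>d b L by (intro mult_left_mono) (auto simp: field_simps)
      also have "\<delta> * 2 + L * (\<delta> / b) = G * \<delta>" by (simp add: G_def algebra_simps)
      finally have "D \<le> G * \<delta>" by simp
      then have "k \<le> (1 / D) powr q"
        unfolding k_def using D G \<delta> p by (intro powr_mono2 divide_left_mono) (auto simp: q_def)
      also have "\<dots> = norm (?F (\<phi> z)) powr p"
        using norm_kernel_power[OF a, of "\<phi> z" m p] \<phi>1 by (simp add: D_def q_def)
      finally have "k * norm (u z) powr p \<le> norm (?F (\<phi> z)) powr p * norm (u z) powr p"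
        by (intro mult_right_mono) auto
      then show ?thesis by (simp add: weighted_composition_def norm_mult powr_mult mult.commute)
    qed
    have k0: "0 < k" using G \<delta> by (simp add: k_def)
    have IF: "bergman_integral p \<omega> ?F \<le> ennreal (12 * C\<^sup>2 * (4 / \<delta>) powr q * \<delta> * T (1 - \<delta>))"
      using bergman_integral_kernel_power[OF p less_imp_le[OF m] a] by (simp add: \<delta>_def q_def)
    then have F: "?F \<in> bergman_space p \<omega>"
      using kernel_power_holomorphic[OF a] by (auto simp: bergman_space_def intro: le_less_trans)
    have "ennreal (k * norm (u z0) powr p * d * T (1 - d) / (6 * A * C))
      \<le> bergman_integral p \<omega> (weighted_composition u \<phi> ?F)"
      using bergman_integral_local_lower_bound[OF u p z0, of k "weighted_composition u \<phi> ?F"] near k0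
      by (simp add: d_def)
    also have "\<dots> \<le> ennreal M * bergman_integral p \<omega> ?F" by (rule M(2)[OF F])
    also have "\<dots> \<le> ennreal M * ennreal (12 * C\<^sup>2 * (4 / \<delta>) powr q * \<delta> * T (1 - \<delta>))"
      by (intro mult_left_mono IF) auto
    also have "\<dots> = ennreal (M * (12 * C\<^sup>2 * (4 / \<delta>) powr q * \<delta> * T (1 - \<delta>)))"
      using M(1) \<delta> tail_nonneg[of "1 - \<delta>"] by (simp flip: ennreal_mult)
    finally have "k * norm (u z0) powr p * d * T (1 - d) / (6 * A * C) \<le> M * (12 * C\<^sup>2 * (4 / \<delta>) powr q * \<delta> * T (1 - \<delta>))"
      using M(1) \<delta> tail_nonneg[of "1 - \<delta>"] by (subst (asm) ennreal_le_iff) auto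
    \<comment> \<open>Both bounds carry the same power of \<delta>, so only a constant remains of
      their quotient.\<close>
    also have "(4 / \<delta>) powr q = (4 * G) powr q * k"
      unfolding k_def using G \<delta> by (simp flip: powr_mult)
    also have "M * (12 * C\<^sup>2 * ((4 * G) powr q * k) * \<delta> * T (1 - \<delta>))
      \<le> M * (12 * C\<^sup>2 * ((4 * G) powr q * k) * (K * d) * (Q * T (1 - d)))"
      using M(1) k0 \<delta> \<delta>d d K Q tail_nonneg[of "1 - \<delta>"] by (intro mult_mono mult_left_mono mult_nonneg_nonneg) auto
    also have "\<dots> = X / (6 * A * C) * (k * d * T (1 - d))"
      using A(1) C1 by (simp add: X_def)
    finally have "norm (u z0) powr p / (6 * A * C) * (k * d * T (1 - d)) \<le> X / (6 * A * C) * (k * d * T (1 - d))"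
      by (simp add: mult_ac)
    \<comment> \<open>The whole dependence on \<open>z0\<close> apart from \<open>u z0\<close> sits
      in this factor; its positivity permits the cancellation.\<close>
    moreover have "0 < k * d * T (1 - d)" using k0 d tail_pos[of "1 - d"] by simp
    ultimately have "norm (u z0) powr p / (6 * A * C) \<le> X / (6 * A * C)"
      by (simp only: mult_le_cancel_right_pos)
    moreover have "0 < 6 * A * C" using A(1) C1 by simp
    ultimately show ?thesis by (simp add: divide_le_cancel)
  qed
  \<comment> \<open>\<open>X\<close> bounds the \<open>p\<close>-th power of the modulus; where the
    modulus exceeds 1 it is at most that power, so no root has to be taken.\<close>
  have "norm (u z) \<le> max 1 X" if z: "z \<in> unit_disk" for z
  proof (cases "norm (u z) \<le> 1")
    case False
    then have "norm (u z) powr 1 \<le> norm (u z) powr p" using p by (intro powr_mono) auto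
    then show ?thesis using main[of z] z by simp
  qed simp
  then show ?thesis unfolding bounded_iff by blast
qed

end

theorem theorem5:
  fixes p :: real and \<omega> :: "complex \<Rightarrow> real" and \<phi> u :: "complex \<Rightarrow> complex"
  assumes "1 < p"
    and "\<omega> \<in> regular_weights"
    and "finite_Blaschke_product \<phi>"
    and "u \<in> bergman_space p \<omega>"
    and "bounded_on_bergman_space p \<omega> (weighted_composition u \<phi>)"
  shows "u \<in> H_infinity"
proof -
  obtain C where "regular_weight \<omega> C" using regular_weights_obtain[OF assms(2)] .
  then interpret regular_weight \<omega> C .
  have u: "u holomorphic_on unit_disk" using assms(4) by (simp add: bergman_space_def)
  have "bounded (u ` unit_disk)" using symbol_bounded[OF _ assms(3) u assms(5)] assms(1) by simp
  with u show ?thesis by (simp add: H_infinity_def)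
qed

end
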